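(* There exist a stable 2-coloring of pairs $f:[\omega]^2\to 2$ and a family $Y$ of infinite subsets of $\omega$ such that (i) for every $P\in Y$, no $(f\oplus P)$-computable set is p-homogeneous for $f$; and (ii) every stable 2-coloring of pairs $f':[\omega]^2\to 2$ with $f'\le_T f$ either has an $(f\oplus P)$-computable increasing p-homogeneous set for some $P\in Y$, or else has some increasing p-homogeneous set which computes no set p-homogeneous for $f$.
   Context: A 2-coloring of pairs is $f:[\omega]^2\to 2$, with $f(x,y)$ meaning $f(\{x,y\})$ for $x<y$; it is stable if $\lim_u f(x,u)$ exists for all $x$. $A\oplus B=\{2x:x\in A\}\cup\{2y+1:y\in B\}$. A set $H=H_L\oplus H_R$ with $H_L,H_R$ infinite is p-homogeneous for a coloring $g$ if $g(\{x,y\})$ is constant over $x\in H_L$, $y\in H_R$, $x\neq y$; it is increasing p-homogeneous for $g$ if $g(x,y)$ is constant over $x\in H_L$, $y\in H_R$, $x<y$. *)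

theory Defs
  imports Main "HOL-Library.Nat_Bijection"
begin

datatype rf = Zero | Succ | Proj nat | Comp rf "rf list" | Prim rf rf | Mu rf | Oracle

inductive eval :: "nat set \<Rightarrow> rf \<Rightarrow> nat list \<Rightarrow> nat \<Rightarrow> bool" for A :: "nat set" where
  zero: "eval A Zero xs 0"
| succ: "eval A Succ (x # xs) (Suc x)"
| proj: "i < length xs \<Longrightarrow> eval A (Proj i) xs (xs ! i)"
| orac: "eval A Oracle (x # xs) (if x \<in> A then 1 else 0)"
| comp: "list_all2 (\<lambda>g y. eval A g xs y) gs ys \<Longrightarrow> eval A f ys z \<Longrightarrow> eval A (Comp f gs) xs z"
| prim0: "eval A f xs y \<Longrightarrow> eval A (Prim f g) (0 # xs) y"
| primS: "eval A (Prim f g) (n # xs) y \<Longrightarrow> eval A g (n # y # xs) z \<Longrightarrow> eval A (Prim f g) (Suc n # xs) z"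
| mu: "eval A f (n # xs) 0 \<Longrightarrow> (\<forall>m<n. \<exists>k. eval A f (m # xs) (Suc k)) \<Longrightarrow> eval A (Mu f) xs n"

definition turing_reducible :: "nat set \<Rightarrow> nat set \<Rightarrow> bool" where
  "turing_reducible B A \<longleftrightarrow> (\<exists>t. \<forall>x. eval A t [x] (if x \<in> B then 1 else 0))"

text \<open>A 2-coloring of pairs is f :: nat => nat => bool, where f x y (for x < y) is the colour
  of {x,y}; values for x >= y are irrelevant.\<close>

definition join :: "nat set \<Rightarrow> nat set \<Rightarrow> nat set" where
  "join A B = {2 * x | x. x \<in> A} \<union> {2 * y + 1 | y. y \<in> B}"

definition code :: "(nat \<Rightarrow> nat \<Rightarrow> bool) \<Rightarrow> nat set" where
  "code f = {prod_encode (x, y) | x y. x < y \<and> f x y}"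

definition stable :: "(nat \<Rightarrow> nat \<Rightarrow> bool) \<Rightarrow> bool" where
  "stable f \<longleftrightarrow> (\<forall>x. \<exists>c N. \<forall>u > N. f x u = c)"

definition p_homogeneous :: "(nat \<Rightarrow> nat \<Rightarrow> bool) \<Rightarrow> nat set \<Rightarrow> bool" where
  "p_homogeneous g H \<longleftrightarrow> (\<exists>L R. H = join L R \<and> infinite L \<and> infinite R \<and>
     (\<exists>c. \<forall>x\<in>L. \<forall>y\<in>R. x \<noteq> y \<longrightarrow> g (min x y) (max x y) = c))"

definition inc_p_homogeneous :: "(nat \<Rightarrow> nat \<Rightarrow> bool) \<Rightarrow> nat set \<Rightarrow> bool" where
  "inc_p_homogeneous g H \<longleftrightarrow> (\<exists>L R. H = join L R \<and> infinite L \<and> infinite R \<and>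
     (\<exists>c. \<forall>x\<in>L. \<forall>y\<in>R. x < y \<longrightarrow> g x y = c))"

end

(* The family Y can be taken empty: f is built so that every stable f' computable from f has an
   increasing p-homogeneous H computing no p-homogeneous set for f.

   f is generic for finite conditions deciding f on an initial square together with the limits of the
   columns met so far. All elements of L and R in a set p-homogeneous for f have the same limit, and
   f takes that limit as its value on every pair from L and R. For each f' one grows two candidates
   H_0, H_1, one for each colour, inside a common reservoir X, which is thinned by the
   Nash-Williams theorem so that every finite stem has a well-defined set of outputs that all its
   continuations in X agree on. To defeat one of two given functionals, suppose H_1 resists. Then
   each far e in X carries an output w with the property that, once the limit of w is chosen suitably,
   no extension can force e to have f'-limit 1, since H_1 could then be extended by e and its
   functional would output two elements with distinct limits. So e has f'-limit 0 whatever else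
   f does. This lets H_0 grow without committing f to the limits of its outputs, until f can
   still be made to differ from the limit on a pair of outputs of H_0. *)

theory Submission
  imports Defs "HOL-Library.Countable" "HOL-Library.Infinite_Set"
begin

text \<open>A functional is refuted by two outputs with different limits, or by a left output
  \<open>z\<close> and a later right output \<open>w\<close> with \<open>f z w\<close> unlike the
  limit of \<open>z\<close>. Adding a right element to a stem is free, and a fresh output
  \<open>w\<close> can then simply receive the opposite limit. Adding a left element
  \<open>e\<close> is not free: its \<open>f'\<close>-limit must be forced, and this may depend on
  the limit of the very output that \<open>e\<close> releases. \<open>promise\<close> records this
  conflict for one colour and makes it a resource for the other. The second kind of refutation needs
  \<open>f z w\<close> to be open although the limit of \<open>z\<close> is already chosen, which
  \<open>extends\<close> forbids. Hence two notions of extension: facts stated over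
  \<open>agrees\<close> survive a weak extension, facts stated over \<open>cyl\<close> need not. A
  single visit guarantees the defeat of only one of two functionals, so requirements are indexed by
  pairs, and one of the two sides ends up defeating every functional.\<close>

subsection \<open>Oracle computations\<close>

inductive_cases eval_ZeroE: "eval A Zero xs y"
inductive_cases eval_SuccE: "eval A Succ xs y"
inductive_cases eval_ProjE: "eval A (Proj i) xs y"
inductive_cases eval_OracleE: "eval A Oracle xs y"
inductive_cases eval_CompE: "eval A (Comp f gs) xs y"
inductive_cases eval_PrimE: "eval A (Prim f g) xs y"
inductive_cases eval_MuE: "eval A (Mu f) xs y"

lemma list_all2_det:
  assumes "list_all2 (\<lambda>g y. Q g y \<and> (\<forall>z. Q g z \<longrightarrow> z = y)) gs ys" "list_all2 Q gs zs"
  shows "zs = ys"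
  using assms by (induction gs ys arbitrary: zs rule: list_all2_induct) (auto simp: list_all2_Cons1)

lemma eval_det: "eval A t xs y \<Longrightarrow> eval A t xs z \<Longrightarrow> z = y"
proof (induction arbitrary: z rule: eval.induct)
  case (comp xs gs ys f y)
  from comp.prems obtain zs where zs: "list_all2 (\<lambda>g y. eval A g xs y) gs zs" "eval A f zs z"
    by (auto elim: eval_CompE)
  have "zs = ys"
    by (rule list_all2_det[OF _ zs(1)]) (use comp.IH(1) in \<open>simp add: list_all2_conv_all_nth\<close>)
  with zs(2) comp.IH(2) show ?case by blast
next
  case (primS f g n xs y z')
  from primS.prems show ?case
    by (rule eval_PrimE) (use primS.IH in auto)
next
  case (mu f n xs)
  from mu.prems have 1: "eval A f (z # xs) 0" "\<forall>m<z. \<exists>k. eval A f (m # xs) (Suc k)"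
    by (auto elim: eval_MuE)
  have "\<not> z < n" using 1(1) mu.IH(2) by blast
  moreover have "\<not> n < z" using 1(2) mu.IH(1) by blast
  ultimately show ?case by simp
next
  case (prim0 f xs y g)
  from prim0.prems show ?case
    by (rule eval_PrimE) (use prim0.IH in auto)
qed (erule eval_ZeroE eval_SuccE eval_ProjE eval_OracleE; simp)+

lemma list_all2_use:
  assumes "list_all2 (\<lambda>g y. \<exists>u::nat. \<forall>B. (\<forall>i<u. i \<in> B \<longleftrightarrow> i \<in> A) \<longrightarrow> Q B g y) gs ys"
  shows "\<exists>u. \<forall>B. (\<forall>i<u. i \<in> B \<longleftrightarrow> i \<in> A) \<longrightarrow> list_all2 (Q B) gs ys"
  using assms
proof (induction rule: list_all2_induct)
  case (Cons g gs y ys)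
  then obtain u v where "\<forall>B. (\<forall>i<u. i \<in> B \<longleftrightarrow> i \<in> A) \<longrightarrow> Q B g y"
    "\<forall>B. (\<forall>i<v. i \<in> B \<longleftrightarrow> i \<in> A) \<longrightarrow> list_all2 (Q B) gs ys" by blast
  then have "\<forall>B. (\<forall>i<max u v. i \<in> B \<longleftrightarrow> i \<in> A) \<longrightarrow> list_all2 (Q B) (g # gs) (y # ys)"
    by (simp add: less_max_iff_disj)
  then show ?case by blast
qed simp

lemma bounded_use:
  assumes "\<forall>m<n::nat. \<exists>u::nat. \<forall>B. (\<forall>i<u. i \<in> B \<longleftrightarrow> i \<in> A) \<longrightarrow> Q B m"
  shows "\<exists>u. \<forall>B. (\<forall>i<u. i \<in> B \<longleftrightarrow> i \<in> A) \<longrightarrow> (\<forall>m<n. Q B m)"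
  using assms
proof (induction n)
  case (Suc n)
  then obtain u v where "\<forall>B. (\<forall>i<u. i \<in> B \<longleftrightarrow> i \<in> A) \<longrightarrow> (\<forall>m<n. Q B m)"
    "\<forall>B. (\<forall>i<v. i \<in> B \<longleftrightarrow> i \<in> A) \<longrightarrow> Q B n" using less_Suc_eq by auto
  then have "\<forall>B. (\<forall>i<max u v. i \<in> B \<longleftrightarrow> i \<in> A) \<longrightarrow> (\<forall>m<Suc n. Q B m)"
    by (simp add: less_max_iff_disj less_Suc_eq)
  then show ?case by blast
qed simp

text \<open>A halting computation queries only finitely many oracle bits. Both continuity facts used
  later rest on this: openness of \<open>outputs\<close> and the locale axiom \<open>F_use\<close>
  for \<open>computed_color\<close>.\<close>

lemma eval_use:
  "eval A t xs y \<Longrightarrow> \<exists>u. \<forall>B. (\<forall>i<u. i \<in> B \<longleftrightarrow> i \<in> A) \<longrightarrow> eval B t xs y"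
proof (induction rule: eval.induct)
  case (orac x xs)
  have "\<forall>B. (\<forall>i<Suc x. i \<in> B \<longleftrightarrow> i \<in> A) \<longrightarrow> eval B Oracle (x # xs) (if x \<in> A then 1 else 0)"
    using eval.orac by (metis lessI)
  then show ?case by blast
next
  case (comp xs gs ys f z)
  have "\<exists>u. \<forall>B. (\<forall>i<u. i \<in> B \<longleftrightarrow> i \<in> A) \<longrightarrow> list_all2 (\<lambda>g y. eval B g xs y) gs ys"
    by (rule list_all2_use) (use comp.IH(1) in \<open>simp add: list_all2_conv_all_nth\<close>)
  with comp.IH(2) obtain u v where "\<forall>B. (\<forall>i<u. i \<in> B \<longleftrightarrow> i \<in> A) \<longrightarrow> eval B f ys z"
    "\<forall>B. (\<forall>i<v. i \<in> B \<longleftrightarrow> i \<in> A) \<longrightarrow> list_all2 (\<lambda>g y. eval B g xs y) gs ys" by blast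
  then have "\<forall>B. (\<forall>i<max u v. i \<in> B \<longleftrightarrow> i \<in> A) \<longrightarrow> eval B (Comp f gs) xs z"
    by (intro allI impI, intro eval.comp[where ys = ys]) (simp_all add: less_max_iff_disj)
  then show ?case by blast
next
  case (primS f g n xs y z)
  then obtain u v where "\<forall>B. (\<forall>i<u. i \<in> B \<longleftrightarrow> i \<in> A) \<longrightarrow> eval B (Prim f g) (n # xs) y"
    "\<forall>B. (\<forall>i<v. i \<in> B \<longleftrightarrow> i \<in> A) \<longrightarrow> eval B g (n # y # xs) z" by blast
  then have "\<forall>B. (\<forall>i<max u v. i \<in> B \<longleftrightarrow> i \<in> A) \<longrightarrow> eval B (Prim f g) (Suc n # xs) z"
    by (metis eval.primS less_max_iff_disj)
  then show ?case by blast
next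
  case (mu f n xs)
  have "\<exists>u. \<forall>B. (\<forall>i<u. i \<in> B \<longleftrightarrow> i \<in> A) \<longrightarrow> (\<forall>m<n. \<exists>k. eval B f (m # xs) (Suc k))"
  proof (rule bounded_use, intro allI impI)
    fix m assume "m < n"
    with mu.IH(2) obtain k u where "\<forall>B. (\<forall>i<u. i \<in> B \<longleftrightarrow> i \<in> A) \<longrightarrow> eval B f (m # xs) (Suc k)" by meson
    then show "\<exists>u. \<forall>B. (\<forall>i<u. i \<in> B \<longleftrightarrow> i \<in> A) \<longrightarrow> (\<exists>k. eval B f (m # xs) (Suc k))" by meson
  qed
  then obtain v where v: "\<forall>B. (\<forall>i<v. i \<in> B \<longleftrightarrow> i \<in> A) \<longrightarrow> (\<forall>m<n. \<exists>k. eval B f (m # xs) (Suc k))" ..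
  from mu.IH(1) obtain u where u: "\<forall>B. (\<forall>i<u. i \<in> B \<longleftrightarrow> i \<in> A) \<longrightarrow> eval B f (n # xs) 0" ..
  have "\<forall>B. (\<forall>i<max u v. i \<in> B \<longleftrightarrow> i \<in> A) \<longrightarrow> eval B (Mu f) xs n"
    using u v by (intro allI impI, intro eval.mu) (simp_all add: less_max_iff_disj)
  then show ?case by blast
qed (blast intro: eval.intros)+

instance rf :: countable
  by countable_datatype

subsection \<open>Alternating sets\<close>

definition ev :: "nat set \<Rightarrow> nat set" where
  "ev Z = {x \<in> Z. even (card (Z \<inter> {..<x}))}"

definition od :: "nat set \<Rightarrow> nat set" where
  "od Z = {x \<in> Z. odd (card (Z \<inter> {..<x}))}"

text \<open>An infinite set \<open>Z\<close> codes the candidate whose left and right halves are the elements of \<open>Z\<close> at even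
  and at odd positions; a single set is coded because the partition theorem below fails for
  pairs of sets.\<close>

definition alt :: "nat set \<Rightarrow> nat set" where
  "alt Z = join (ev Z) (od Z)"

lemma in_join [simp]:
  "2 * x \<in> join L R \<longleftrightarrow> x \<in> L" "Suc (2 * y) \<in> join L R \<longleftrightarrow> y \<in> R"
proof -
  have 1: "2 * x \<noteq> Suc (2 * y)" "Suc (2 * y) \<noteq> 2 * x" for x y :: nat by presburger+
  show "2 * x \<in> join L R \<longleftrightarrow> x \<in> L" by (simp add: join_def 1)
  show "Suc (2 * y) \<in> join L R \<longleftrightarrow> y \<in> R" by (simp add: join_def 1)
qed

text \<open>The number \<open>i\<close> codes some \<open>x \<le> i\<close>, and the parity of the
  position of \<open>x\<close> depends only on the part of the set below \<open>x\<close>; so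
  \<open>alt\<close> is continuous with the identity as modulus.\<close>

lemma alt_agree:
  assumes "Z' \<inter> {..<u} = Z \<inter> {..<u}" "i < u"
  shows "i \<in> alt Z' \<longleftrightarrow> i \<in> alt Z"
proof -
  have *: "Z' \<inter> {..<x} = Z \<inter> {..<x}" "x \<in> Z' \<longleftrightarrow> x \<in> Z" if "x \<le> i" for x
  proof -
    have u: "{..<x} = {..<u} \<inter> {..<x}" "x < u" using that assms(2) by auto
    show "Z' \<inter> {..<x} = Z \<inter> {..<x}" using assms(1) u(1) by (metis Int_assoc)
    show "x \<in> Z' \<longleftrightarrow> x \<in> Z" using assms(1) u(2) by (metis IntI Int_iff lessThan_iff)
  qed
  show ?thesis
  proof (cases "even i")
    case True
    then obtain x where "i = 2 * x" by blast
    with *[of x] show ?thesis by (simp add: alt_def ev_def)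
  next
    case False
    then obtain x where "i = Suc (2 * x)" using oddE by fastforce
    with *[of x] show ?thesis by (simp add: alt_def od_def)
  qed
qed

lemma ev_initial:
  assumes "\<And>a y. a \<in> s \<Longrightarrow> y \<in> Y \<Longrightarrow> a < y"
  shows "ev (s \<union> Y) \<inter> s = ev s" "od (s \<union> Y) \<inter> s = od s"
proof -
  have "(s \<union> Y) \<inter> {..<x} = s \<inter> {..<x}" if "x \<in> s" for x
    using assms that by fastforce
  then show "ev (s \<union> Y) \<inter> s = ev s" "od (s \<union> Y) \<inter> s = od s"
    by (auto simp: ev_def od_def)
qed

lemma ev_insert:
  assumes "\<And>a. a \<in> s \<Longrightarrow> a < x"
  shows "ev (insert x s) = (if even (card s) then insert x (ev s) else ev s)"
    "od (insert x s) = (if even (card s) then od s else insert x (od s))"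
proof -
  have 1: "insert x s \<inter> {..<y} = s \<inter> {..<y}" if "y \<in> s" for y using assms[OF that] by auto
  have 2: "insert x s \<inter> {..<x} = s" using assms by auto
  have 3: "x \<notin> s" using assms by blast
  have "y \<in> ev (insert x s) \<longleftrightarrow> y \<in> (if even (card s) then insert x (ev s) else ev s)"
    "y \<in> od (insert x s) \<longleftrightarrow> y \<in> (if even (card s) then od s else insert x (od s))" for y
    using 1[of y] 2 3 by (cases "y = x"; cases "y \<in> s"; simp add: ev_def od_def)+
  then show "ev (insert x s) = (if even (card s) then insert x (ev s) else ev s)"
    "od (insert x s) = (if even (card s) then od s else insert x (od s))"
    by (intro set_eqI, blast)+
qed

lemma ev_subset: "ev Z \<subseteq> Z" "od Z \<subseteq> Z"
  by (auto simp: ev_def od_def)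

text \<open>An element of \<open>Z\<close> and its successor in \<open>Z\<close> sit at positions of
  opposite parity.\<close>

lemma infinite_ev_od:
  assumes "infinite Z"
  shows "infinite (ev Z)" "infinite (od Z)"
proof -
  have "(\<exists>x>m. x \<in> ev Z) \<and> (\<exists>x>m. x \<in> od Z)" for m
  proof -
    obtain y where y: "y \<in> Z" "m < y" using assms unfolding infinite_nat_iff_unbounded by blast
    obtain z0 where z0: "z0 \<in> Z" "y < z0" using assms unfolding infinite_nat_iff_unbounded by blast
    define z where "z = (LEAST z. z \<in> Z \<and> y < z)"
    have z: "z \<in> Z" "y < z" unfolding z_def using LeastI[of "\<lambda>z. z \<in> Z \<and> y < z" z0] z0 by auto
    have "\<not> (x \<in> Z \<and> y < x)" if "x < z" for x using not_less_Least that unfolding z_def by blast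
    then have "Z \<inter> {..<z} = insert y (Z \<inter> {..<y})" using y z by (force simp: not_less)
    then have "card (Z \<inter> {..<z}) = Suc (card (Z \<inter> {..<y}))" by simp
    then show ?thesis using y z unfolding ev_def od_def
      by (cases "even (card (Z \<inter> {..<y}))") (auto intro: exI[of _ y] exI[of _ z])
  qed
  then show "infinite (ev Z)" "infinite (od Z)" unfolding infinite_nat_iff_unbounded by auto
qed

subsection \<open>Ramsey theory of infinite sets\<close>

text \<open>Dependent choice along \<open>\<T>\<close>. The family need not be closed under subsets;
  only the stems met on the way, which are the initial parts of \<open>t0 \<union> Y\<close> from
  \<open>t0\<close> on, have to belong to it.\<close>

lemma chain_exists:
  fixes X :: "nat set" and \<T> :: "nat set set"
  assumes t0: "t0 \<in> \<T>" and fin: "\<And>t. t \<in> \<T> \<Longrightarrow> finite t"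
    and step: "\<And>t m. t \<in> \<T> \<Longrightarrow> \<exists>x\<in>X. m \<le> x \<and> insert x t \<in> \<T>"
  obtains Y where "Y \<subseteq> X \<inter> {m..}" "infinite Y" "\<And>a y. a \<in> t0 \<Longrightarrow> y \<in> Y \<Longrightarrow> a < y"
    "\<And>u. t0 \<union> (Y \<inter> {..<u}) \<in> \<T>"
proof -
  define m0 where "m0 = m + Suc (Max (insert 0 t0))"
  have m0: "a < m0" if "a \<in> t0" for a
    using that fin[OF t0] Max_ge[of "insert 0 t0" a] unfolding m0_def by (simp add: less_Suc_eq_le trans_le_add2)
  define P where "P n xt \<longleftrightarrow> fst xt \<in> X \<and> m0 \<le> fst xt \<and> snd xt \<in> \<T> \<and> (n = 0 \<longrightarrow> snd xt = insert (fst xt) t0)"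
    for n :: nat and xt
  define S where "S xt yt \<longleftrightarrow> fst xt < fst yt \<and> snd yt = insert (fst yt) (snd xt)" for xt yt :: "nat \<times> nat set"
  have "\<exists>h. \<forall>n. P n (h n) \<and> S (h n) (h (Suc n))"
  proof (rule dependent_nat_choice)
    obtain x where "x \<in> X" "m0 \<le> x" "insert x t0 \<in> \<T>" using step[OF t0] by blast
    then show "\<exists>xt. P 0 xt" by (intro exI[of _ "(x, insert x t0)"]) (simp add: P_def)
  next
    fix xt :: "nat \<times> nat set" and n :: nat
    assume "P n xt"
    moreover from this obtain x' where "x' \<in> X" "Suc (fst xt) \<le> x'" "insert x' (snd xt) \<in> \<T>"
      using step[of "snd xt" "Suc (fst xt)"] unfolding P_def by blast
    ultimately show "\<exists>yt. P (Suc n) yt \<and> S xt yt"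
      by (intro exI[of _ "(x', insert x' (snd xt))"]) (simp add: P_def S_def)
  qed
  then obtain h where h: "\<forall>n. P n (h n) \<and> S (h n) (h (Suc n))" ..
  define x where "x n = fst (h n)" for n
  define t where "t n = snd (h n)" for n
  have x: "x n \<in> X" "m0 \<le> x n" and t: "t n \<in> \<T>" "t 0 = insert (x 0) t0"
    and S: "x n < x (Suc n)" "t (Suc n) = insert (x (Suc n)) (t n)" for n
    using h[rule_format, of n] h[rule_format, of 0] by (simp_all add: x_def t_def P_def S_def)
  have tn: "t n = t0 \<union> x ` {..n}" for n
    by (induction n) (auto simp: t(2) S(2) atMost_Suc)
  have sm: "strict_mono x" using S(1) by (simp add: strict_mono_Suc_iff)
  show ?thesis
  proof (rule that[of "range x"])
    show "range x \<subseteq> X \<inter> {m..}" using x(1) order_trans[OF _ x(2), of m] by (auto simp: m0_def)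
    show "infinite (range x)" using sm by (simp add: finite_image_iff strict_mono_imp_inj_on range_inj_infinite)
    show "a < y" if "a \<in> t0" "y \<in> range x" for a y using m0[OF that(1)] x(2) that(2) by (fastforce intro: less_le_trans)
    show "t0 \<union> (range x \<inter> {..<u}) \<in> \<T>" for u
    proof (cases "x 0 < u")
      case False
      then have "range x \<inter> {..<u} = {}" using sm by (auto simp: not_less) (meson le0 le_trans leD strict_mono_less_eq)
      then show ?thesis using t0 by simp
    next
      case True
      define k where "k = (GREATEST k. x k < u)"
      have "i \<le> u" if "x i < u" for i using sm strict_mono_imp_increasing[of x i] that by simp
      then have "x k < u" "\<And>i. x i < u \<Longrightarrow> i \<le> k"
        unfolding k_def using True by (metis (mono_tags, lifting) GreatestI_nat, metis (mono_tags, lifting) Greatest_le_nat)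
      then have "range x \<inter> {..<u} = x ` {..k}" using sm by (auto simp: strict_mono_less_eq intro: le_less_trans[of _ "x k"])
      then show ?thesis using t(1)[of k] tn[of k] by simp
    qed
  qed
qed

text \<open>Removes thresholds that depend on a stem: inside \<open>X'\<close>, whatever holds past
  \<open>m s\<close> holds for every element above \<open>s\<close>. Each new element is picked
  beyond \<open>m s\<close> for the finitely many subsets \<open>s\<close> of the elements picked so
  far.\<close>

lemma sparse_subset:
  fixes X :: "nat set" and m :: "nat set \<Rightarrow> nat"
  assumes "infinite X"
  obtains X' where "X' \<subseteq> X" "infinite X'"
    "\<And>s x. finite s \<Longrightarrow> s \<subseteq> X' \<Longrightarrow> x \<in> X' \<Longrightarrow> (\<And>a. a \<in> s \<Longrightarrow> a < x) \<Longrightarrow> m s \<le> x"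
proof -
  define \<T> where "\<T> = {t. finite t \<and> (\<forall>x\<in>t. \<forall>s\<subseteq>t \<inter> {..<x}. m s \<le> x)}"
  have "\<exists>x\<in>X. k \<le> x \<and> insert x t \<in> \<T>" if t: "t \<in> \<T>" for t k
  proof -
    have ft: "finite t" using t by (simp add: \<T>_def)
    define b where "b = Max (insert k (t \<union> m ` Pow t))"
    have fin: "finite (insert k (t \<union> m ` Pow t))" using ft by simp
    obtain x where x: "x \<in> X" "b < x" using assms unfolding infinite_nat_iff_unbounded by blast
    have le: "i \<le> b" if "i \<in> insert k (t \<union> m ` Pow t)" for i unfolding b_def using Max_ge[OF fin that] .
    have "m s \<le> y" if y: "y \<in> insert x t" and s: "s \<subseteq> insert x t \<inter> {..<y}" for y s
    proof (cases "y = x")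
      case True
      then have "s \<subseteq> t" using s by auto
      then show ?thesis using le[of "m s"] x(2) True by auto
    next
      case False
      then have "y < x" using le[of y] y x by auto
      then have "s \<subseteq> t \<inter> {..<y}" using s by auto
      then show ?thesis using t y False by (auto simp: \<T>_def)
    qed
    then have "insert x t \<in> \<T>" using ft by (simp add: \<T>_def)
    moreover have "k \<le> x" using x(2) le[of k] by simp
    ultimately show ?thesis using x(1) by blast
  qed
  moreover have "{} \<in> \<T>" by (simp add: \<T>_def)
  moreover have "\<And>t. t \<in> \<T> \<Longrightarrow> finite t" by (simp add: \<T>_def)
  ultimately obtain Y where Y: "Y \<subseteq> X \<inter> {0..}" "infinite Y" "\<And>u. {} \<union> (Y \<inter> {..<u}) \<in> \<T>"
    using chain_exists[of "{}" \<T> X 0] by metis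
  show ?thesis
  proof (rule that[of Y])
    fix s x assume "finite s" "s \<subseteq> Y" "x \<in> Y" "\<And>a. a \<in> s \<Longrightarrow> a < x"
    moreover from this have "s \<subseteq> Y \<inter> {..<Suc x} \<inter> {..<x}" by fastforce
    ultimately show "m s \<le> x" using Y(3)[of "Suc x"] unfolding \<T>_def by auto
  qed (use Y in auto)
qed

text \<open>Diagonal intersection: \<open>x n\<close> is picked from a decreasing sequence
  \<open>Z n\<close>, where \<open>Z n\<close> meets the requirement numbered \<open>n\<close>, and
  the tail from \<open>x n\<close> lies in \<open>Z n\<close>. Only a tail can be controlled, since
  earlier elements are picked before that requirement is treated.\<close>

lemma diagonal_subset:
  fixes D :: "'i::countable \<Rightarrow> nat set \<Rightarrow> bool"
  assumes ex: "\<And>i X. infinite X \<Longrightarrow> \<exists>X'\<subseteq>X. infinite X' \<and> D i X'"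
    and her: "\<And>i X X'. D i X \<Longrightarrow> X' \<subseteq> X \<Longrightarrow> infinite X' \<Longrightarrow> D i X'"
    and X: "infinite X"
  obtains X' where "X' \<subseteq> X" "infinite X'" "\<And>i. \<exists>m. D i (X' \<inter> {m..})"
proof -
  define P where "P n xZ \<longleftrightarrow> fst xZ \<in> snd xZ \<and> snd xZ \<subseteq> X \<and> infinite (snd xZ) \<and> D (from_nat n) (snd xZ)" for n xZ
  define S where "S xZ yW \<longleftrightarrow> fst xZ < fst yW \<and> snd yW \<subseteq> snd xZ" for xZ yW :: "nat \<times> nat set"
  have "\<exists>h. \<forall>n. P n (h n) \<and> S (h n) (h (Suc n))"
  proof (rule dependent_nat_choice)
    obtain Z where Z: "Z \<subseteq> X" "infinite Z" "D (from_nat 0) Z" using ex[OF X] by blast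
    then obtain x where "x \<in> Z" by fastforce
    with Z show "\<exists>xZ. P 0 xZ" by (intro exI[of _ "(x, Z)"]) (simp add: P_def)
  next
    fix xZ :: "nat \<times> nat set" and n :: nat
    assume a: "P n xZ"
    then obtain Z where Z: "Z \<subseteq> snd xZ" "infinite Z" "D (from_nat (Suc n)) Z"
      using ex[of "snd xZ" "from_nat (Suc n)"] unfolding P_def by blast
    then obtain x where "x \<in> Z" "fst xZ < x" unfolding infinite_nat_iff_unbounded by blast
    with Z a show "\<exists>yW. P (Suc n) yW \<and> S xZ yW" by (intro exI[of _ "(x, Z)"]) (auto simp: P_def S_def)
  qed
  then obtain h where h: "\<forall>n. P n (h n) \<and> S (h n) (h (Suc n))" ..
  define x where "x n = fst (h n)" for n
  define Z where "Z n = snd (h n)" for n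
  have x: "x n \<in> Z n" "Z n \<subseteq> X" "D (from_nat n) (Z n)"
    and S: "x n < x (Suc n)" "Z (Suc n) \<subseteq> Z n" for n
    using h[rule_format, of n] by (simp_all add: x_def Z_def P_def S_def)
  have sm: "strict_mono x" using S(1) by (simp add: strict_mono_Suc_iff)
  have inf: "infinite (range x)" using sm by (simp add: strict_mono_imp_inj_on range_inj_infinite)
  have Zm: "Z k \<subseteq> Z n" if "n \<le> k" for n k using lift_Suc_antimono_le[of Z, OF S(2) that] .
  show ?thesis
  proof (rule that[of "range x"])
    show "range x \<subseteq> X" using x by blast
    show "infinite (range x)" by (rule inf)
    fix i :: 'i
    define n where "n = to_nat i"
    have "range x \<inter> {x n..} \<subseteq> Z n"
      using Zm x(1) sm by (auto simp: strict_mono_less_eq) (meson subsetD)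
    moreover have "infinite (range x \<inter> {x n..})"
      using inf by (metis Diff_Compl finite_Diff2 finite_lessThan Compl_atLeast)
    ultimately have "D i (range x \<inter> {x n..})" using her[OF x(3)[of n]] by (simp add: n_def)
    then show "\<exists>m. D i (range x \<inter> {m..})" by blast
  qed
qed

text \<open>Openness in the product topology on the power set of the naturals.\<close>

definition is_open :: "(nat set \<Rightarrow> bool) \<Rightarrow> bool" where
  "is_open Q \<longleftrightarrow> (\<forall>Z. Q Z \<longrightarrow> (\<exists>u. \<forall>Z'. Z' \<inter> {..<u} = Z \<inter> {..<u} \<longrightarrow> Q Z'))"

lemma opnD:
  assumes "is_open Q" "Q Z"
  obtains u where "\<And>Z'. Z' \<inter> {..<u} = Z \<inter> {..<u} \<Longrightarrow> Q Z'"
  using assms unfolding is_open_def by blast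

lemma is_open_union: "is_open Q \<Longrightarrow> is_open (\<lambda>Y. Q (s \<union> Y))"
  unfolding is_open_def by (metis Int_Un_distrib2)

lemma is_open_ex: "(\<And>i. is_open (Q i)) \<Longrightarrow> is_open (\<lambda>Z. \<exists>i. R i \<and> Q i Z)"
  unfolding is_open_def by metis

lemma infinite_tail: "infinite X \<Longrightarrow> infinite (X \<inter> {m::nat..})"
  by (metis Diff_Compl finite_Diff2 finite_lessThan Compl_atLeast)

text \<open>Open sets are Ramsey, by the accept-reject argument. Either the empty stem is accepted,
  or rejection spreads to all finite subsets of a thinner set; then no infinite subset of it
  satisfies \<open>Q\<close>, since openness would make a finite initial part accepted by a
  tail.\<close>

lemma nash_williams:
  assumes Q: "is_open Q" and X: "infinite X"
  obtains X' where "X' \<subseteq> X" "infinite X'"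
    "(\<forall>Y\<subseteq>X'. infinite Y \<longrightarrow> Q Y) \<or> (\<forall>Y\<subseteq>X'. infinite Y \<longrightarrow> \<not> Q Y)"
proof -
  define acc where "acc s X \<longleftrightarrow> (\<forall>Y\<subseteq>X. infinite Y \<and> (\<forall>a\<in>s. \<forall>y\<in>Y. a < y) \<longrightarrow> Q (s \<union> Y))" for s X
  define dec where "dec s X \<longleftrightarrow> acc s X \<or> (\<forall>X'\<subseteq>X. infinite X' \<longrightarrow> \<not> acc s X')" for s X
  have acc_sub: "acc s X'" if "acc s X" "X' \<subseteq> X" for s X X' using that unfolding acc_def by (meson order_trans)
  obtain X1 where X1: "X1 \<subseteq> X" "infinite X1" "\<And>xs. \<exists>m. dec (set xs) (X1 \<inter> {m..})"
  proof (rule diagonal_subset[of "\<lambda>xs::nat list. dec (set xs)" X])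
    show "\<exists>X'\<subseteq>X. infinite X' \<and> dec (set xs) X'" if "infinite X" for X and xs :: "nat list"
      using that unfolding dec_def by (metis order_refl)
    show "dec (set i) X'" if "dec (set i) X" "X' \<subseteq> X" for X X' and i :: "nat list"
      using that acc_sub unfolding dec_def by (meson order_trans)
  qed (use X in blast)+
  have "\<exists>m. finite s \<longrightarrow> dec s (X1 \<inter> {m..})" for s using X1(3) by (metis finite_list)
  then obtain m where m: "\<And>s. finite s \<Longrightarrow> dec s (X1 \<inter> {m s..})" by metis
  obtain X2 where X2: "X2 \<subseteq> X1" "infinite X2"
    "\<And>s x. finite s \<Longrightarrow> s \<subseteq> X2 \<Longrightarrow> x \<in> X2 \<Longrightarrow> (\<And>a. a \<in> s \<Longrightarrow> a < x) \<Longrightarrow> m s \<le> x"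
    using sparse_subset[OF X1(2)] by metis
  have d2: "acc s X2 \<or> (\<forall>X'\<subseteq>X2. infinite X' \<longrightarrow> \<not> acc s X')" if s: "finite s" "s \<subseteq> X2" for s
  proof -
    \<comment> \<open>Elements of \<open>X2\<close> above \<open>s\<close> are automatically past
      \<open>m s\<close>, so acceptance on the tail is acceptance.\<close>
    have *: "acc s X'" if "acc s (X' \<inter> {m s..})" "X' \<subseteq> X2" for X'
      unfolding acc_def
    proof (intro allI impI, elim conjE)
      fix Y assume Y: "Y \<subseteq> X'" "infinite Y" "\<forall>a\<in>s. \<forall>y\<in>Y. a < y"
      then have "Y \<subseteq> X' \<inter> {m s..}" using X2(3)[OF s] that(2) by fastforce
      then show "Q (s \<union> Y)" using that(1)[unfolded acc_def, rule_format, of Y] Y by blast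
    qed
    consider "acc s (X1 \<inter> {m s..})" | "\<forall>X'\<subseteq>X1 \<inter> {m s..}. infinite X' \<longrightarrow> \<not> acc s X'"
      using m[OF s(1)] unfolding dec_def by blast
    then show ?thesis
    proof cases
      case 1
      then have "acc s (X2 \<inter> {m s..})" using acc_sub[OF 1, of "X2 \<inter> {m s..}"] X2(1) by fast
      then show ?thesis using *[of X2] by simp
    next
      case 2
      have "\<not> acc s X'" if "X' \<subseteq> X2" "infinite X'" for X'
      proof
        assume "acc s X'"
        from acc_sub[OF this] have "acc s (X' \<inter> {m s..})" by simp
        moreover have "X' \<inter> {m s..} \<subseteq> X1 \<inter> {m s..}" using that X2(1) by blast
        ultimately show False using 2 infinite_tail[OF that(2)] by blast
      qed
      then show ?thesis by blast
    qed
  qed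
  show ?thesis
  proof (cases "acc {} X2")
    case True
    then have "\<forall>Y\<subseteq>X2. infinite Y \<longrightarrow> Q Y" unfolding acc_def by simp
    then show ?thesis using that[of X2] X2 X1 by blast
  next
    case False
    have "\<exists>k. finite s \<and> s \<subseteq> X2 \<and> \<not> acc s X2 \<longrightarrow> (\<forall>x\<in>X2. (\<forall>a\<in>s. a < x) \<and> k \<le> x \<longrightarrow> \<not> acc (insert x s) X2)" for s
    proof (cases "finite s \<and> s \<subseteq> X2 \<and> \<not> acc s X2")
      case True
      define B where "B = {x \<in> X2. (\<forall>a\<in>s. a < x) \<and> acc (insert x s) X2}"
      \<comment> \<open>If infinitely many one-point extensions of a rejected stem were accepted,
        their set \<open>B\<close> would accept the stem itself: split off the least element of
        \<open>Y\<close>.\<close>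
      have "finite B"
      proof (rule ccontr)
        assume inf: "infinite B"
        have "acc s B" unfolding acc_def
        proof (intro allI impI, elim conjE)
          fix Y assume Y: "Y \<subseteq> B" "infinite Y" "\<forall>a\<in>s. \<forall>y\<in>Y. a < y"
          define x where "x = (LEAST x. x \<in> Y)"
          have x: "x \<in> Y" "\<And>y. y \<in> Y \<Longrightarrow> x \<le> y" unfolding x_def
            using Y(2) by (metis LeastI ex_in_conv finite.emptyI, metis Least_le)
          have ax: "acc (insert x s) X2" using x(1) Y(1) B_def by auto
          moreover have "Y - {x} \<subseteq> X2" using Y(1) B_def by auto
          moreover have "infinite (Y - {x})" using Y(2) by simp
          moreover have "\<forall>a\<in>insert x s. \<forall>y\<in>Y - {x}. a < y" using x(2) Y(3) by (auto simp: order_less_le)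
          ultimately have "Q (insert x s \<union> (Y - {x}))" unfolding acc_def by blast
          moreover have "insert x s \<union> (Y - {x}) = s \<union> Y" using x(1) by blast
          ultimately show "Q (s \<union> Y)" by simp
        qed
        moreover have "B \<subseteq> X2" unfolding B_def by simp
        ultimately show False using d2[of s] True inf by metis
      qed
      then obtain k where "\<forall>x\<in>B. x < k" using finite_nat_set_iff_bounded by blast
      then show ?thesis unfolding B_def by (intro exI[of _ k]) (auto simp: not_less[symmetric])
    qed blast
    then obtain k where k: "\<And>s x. finite s \<Longrightarrow> s \<subseteq> X2 \<Longrightarrow> \<not> acc s X2 \<Longrightarrow> x \<in> X2 \<Longrightarrow> (\<forall>a\<in>s. a < x) \<Longrightarrow> k s \<le> x
       \<Longrightarrow> \<not> acc (insert x s) X2" by metis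
    obtain X3 where X3: "X3 \<subseteq> X2" "infinite X3"
      "\<And>s x. finite s \<Longrightarrow> s \<subseteq> X3 \<Longrightarrow> x \<in> X3 \<Longrightarrow> (\<And>a. a \<in> s \<Longrightarrow> a < x) \<Longrightarrow> k s \<le> x"
      using sparse_subset[OF X2(2)] by metis
    have rej: "\<not> acc s X2" if "finite s" "s \<subseteq> X3" for s
      using that
    proof (induction s rule: finite_linorder_max_induct)
      case empty
      then show ?case using False by simp
    next
      case (insert x s)
      then have s: "s \<subseteq> X2" "x \<in> X2" "k s \<le> x" using X3 by auto
      show ?case using k[OF insert.hyps(1) s(1) _ s(2) insert.hyps(2) s(3)] insert by simp
    qed
    have "\<not> Q Y" if Y: "Y \<subseteq> X3" "infinite Y" for Y
    proof
      assume "Q Y"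
      then obtain u where u: "\<And>Z'. Z' \<inter> {..<u} = Y \<inter> {..<u} \<Longrightarrow> Q Z'" using opnD[OF Q] by blast
      define s where "s = Y \<inter> {..<u}"
      have "acc s (X2 \<inter> {u..})" unfolding acc_def
      proof (intro allI impI)
        fix Z assume "Z \<subseteq> X2 \<inter> {u..}"
        then have "(s \<union> Z) \<inter> {..<u} = Y \<inter> {..<u}" unfolding s_def by auto
        then show "Q (s \<union> Z)" by (rule u)
      qed
      moreover have s: "finite s" "s \<subseteq> X3" using Y(1) by (auto simp: s_def)
      moreover have "\<forall>X'\<subseteq>X2. infinite X' \<longrightarrow> \<not> acc s X'" using d2[OF s(1)] rej[OF s] s(2) X3(1) by simp
      ultimately show False using infinite_tail[OF X2(2), of u] by simp
    qed
    then show ?thesis using that[of X3] X3 X2(1) X1(1) by simp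
  qed
qed

lemma nash_williams_family:
  fixes W :: "'i::countable \<Rightarrow> nat set \<Rightarrow> bool"
  assumes "\<And>i. is_open (W i)" and X: "infinite X"
  obtains X' where "X' \<subseteq> X" "infinite X'"
    "\<And>s i. finite s \<Longrightarrow> \<exists>m. (\<forall>Y\<subseteq>X' \<inter> {m..}. infinite Y \<longrightarrow> W i (s \<union> Y)) \<or>
       (\<forall>Y\<subseteq>X' \<inter> {m..}. infinite Y \<longrightarrow> \<not> W i (s \<union> Y))"
proof -
  \<comment> \<open>Finite stems are represented by lists, because \<open>diagonal_subset\<close>
    needs a countable index type.\<close>
  define D where "D xi X \<longleftrightarrow> (\<forall>Y\<subseteq>X. infinite Y \<longrightarrow> W (snd xi) (set (fst xi) \<union> Y)) \<or>
       (\<forall>Y\<subseteq>X. infinite Y \<longrightarrow> \<not> W (snd xi) (set (fst xi) \<union> Y))" for xi :: "nat list \<times> 'i" and X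
  obtain X' where X': "X' \<subseteq> X" "infinite X'" "\<And>xi. \<exists>m. D xi (X' \<inter> {m..})"
  proof (rule diagonal_subset[of D X])
    show "\<exists>X'\<subseteq>X. infinite X' \<and> D xi X'" if "infinite X" for X and xi :: "nat list \<times> 'i"
      using nash_williams[OF is_open_union[OF assms(1)[of "snd xi"], of "set (fst xi)"] that]
      unfolding D_def by metis
    show "D xi X'" if "D xi X" "X' \<subseteq> X" for X X' and xi :: "nat list \<times> 'i"
      using that unfolding D_def by (meson order_trans)
  qed (use X in blast)+
  show ?thesis
  proof (rule that[OF X'(1,2)])
    fix s :: "nat set" and i :: 'i assume "finite s"
    then obtain xs where "set xs = s" using finite_list by blast
    then show "\<exists>m. (\<forall>Y\<subseteq>X' \<inter> {m..}. infinite Y \<longrightarrow> W i (s \<union> Y)) \<or>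
       (\<forall>Y\<subseteq>X' \<inter> {m..}. infinite Y \<longrightarrow> \<not> W i (s \<union> Y))"
      using X'(3)[of "(xs, i)"] unfolding D_def by simp
  qed
qed

subsection \<open>Virtual outputs\<close>

definition far :: "nat set \<Rightarrow> (nat set \<Rightarrow> bool) \<Rightarrow> bool" where
  "far X Q \<longleftrightarrow> (\<exists>m. \<forall>Y\<subseteq>X \<inter> {m..}. infinite Y \<longrightarrow> Q Y)"

definition forced_outputs :: "(nat \<Rightarrow> nat set \<Rightarrow> bool) \<Rightarrow> nat set \<Rightarrow> nat set \<Rightarrow> nat set" where
  "forced_outputs P X s = {k. far X (\<lambda>Y. P k (s \<union> Y))}"

text \<open>\<open>P k Z\<close> is read as: a fixed functional with oracle \<open>alt Z\<close>
  puts \<open>k\<close> into its output. A union of open predicates is open, so the partition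
  theorem applies to this one as well.\<close>

definition out_left :: "(nat \<Rightarrow> nat set \<Rightarrow> bool) \<Rightarrow> nat \<Rightarrow> nat set \<Rightarrow> bool" where
  "out_left P b Z \<longleftrightarrow> (\<exists>z. b \<le> z \<and> P (2 * z) Z)"

definition out_right :: "(nat \<Rightarrow> nat set \<Rightarrow> bool) \<Rightarrow> nat \<Rightarrow> nat set \<Rightarrow> bool" where
  "out_right P b Z \<longleftrightarrow> (\<exists>w. b \<le> w \<and> P (Suc (2 * w)) Z)"

definition large_odd :: "nat \<Rightarrow> nat set \<Rightarrow> bool" where
  "large_odd b V \<longleftrightarrow> (\<exists>w\<ge>b. Suc (2 * w) \<in> V)"

text \<open>The first three alternatives are Ramsey dichotomies for open predicates. The last is a
  pigeonhole dichotomy on the next stem element; it mentions the forced outputs over the same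
  \<open>X\<close>, so these must survive the thinning that produces it.\<close>

definition settled :: "(nat \<Rightarrow> nat set \<Rightarrow> bool) \<Rightarrow> nat set \<Rightarrow> bool" where
  "settled P X \<longleftrightarrow> infinite X \<and>
     (\<forall>s. finite s \<longrightarrow>
        (\<forall>k. far X (\<lambda>Y. P k (s \<union> Y)) \<or> far X (\<lambda>Y. \<not> P k (s \<union> Y))) \<and>
        (\<forall>b. far X (\<lambda>Y. out_left P b (s \<union> Y)) \<or> far X (\<lambda>Y. \<not> out_left P b (s \<union> Y))) \<and>
        (\<forall>b. far X (\<lambda>Y. out_right P b (s \<union> Y)) \<or> far X (\<lambda>Y. \<not> out_right P b (s \<union> Y))) \<and>
        (\<forall>b. \<exists>m. (\<forall>x\<in>X. m \<le> x \<longrightarrow> large_odd b (forced_outputs P X (insert x s))) \<or>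
                 (\<forall>x\<in>X. m \<le> x \<longrightarrow> \<not> large_odd b (forced_outputs P X (insert x s)))))"

text \<open>Odd numbers are the elements of the right half of a join. When the next element of the stem
  is taken far out in \<open>X\<close>, arbitrarily large right outputs become unavoidable at once.\<close>

definition always_new :: "(nat \<Rightarrow> nat set \<Rightarrow> bool) \<Rightarrow> nat set \<Rightarrow> nat set \<Rightarrow> bool" where
  "always_new P X t \<longleftrightarrow> (\<forall>b. \<exists>m. \<forall>x\<in>X. m \<le> x \<longrightarrow> large_odd b (forced_outputs P X (insert x t)))"

lemma farI: "(\<And>Y. Y \<subseteq> X \<inter> {m..} \<Longrightarrow> infinite Y \<Longrightarrow> Q Y) \<Longrightarrow> far X Q"
  unfolding far_def by blast

lemma farE:
  assumes "far X Q" obtains m where "\<And>Y. Y \<subseteq> X \<inter> {m..} \<Longrightarrow> infinite Y \<Longrightarrow> Q Y"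
  using assms unfolding far_def by blast

lemma far_subset: "far X Q \<Longrightarrow> X' \<subseteq> X \<Longrightarrow> far X' Q"
  unfolding far_def by (meson Int_mono order_refl order_trans)

lemma far_mp: "far X Q \<Longrightarrow> (\<And>Y. Y \<subseteq> X \<Longrightarrow> infinite Y \<Longrightarrow> Q Y \<Longrightarrow> R Y) \<Longrightarrow> far X R"
  unfolding far_def by (meson Int_lower1 order_trans)

lemma far_conj: "far X Q \<Longrightarrow> far X R \<Longrightarrow> far X (\<lambda>Y. Q Y \<and> R Y)"
proof -
  assume "far X Q" "far X R"
  then obtain m m' where "\<And>Y. Y \<subseteq> X \<inter> {m..} \<Longrightarrow> infinite Y \<Longrightarrow> Q Y"
    "\<And>Y. Y \<subseteq> X \<inter> {m'..} \<Longrightarrow> infinite Y \<Longrightarrow> R Y" by (elim farE) blast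
  moreover have "X \<inter> {max m m'..} \<subseteq> X \<inter> {m..}" "X \<inter> {max m m'..} \<subseteq> X \<inter> {m'..}" by auto
  ultimately show ?thesis by (intro farI[of X "max m m'"]) (meson order_trans)
qed

lemma far_not: "far X Q \<Longrightarrow> far X (\<lambda>Y. \<not> Q Y) \<Longrightarrow> finite X"
  using far_conj[of X Q "\<lambda>Y. \<not> Q Y"] infinite_tail[of X] unfolding far_def by blast

text \<open>\<open>insert x s \<union> Y\<close> equals \<open>s \<union> insert x Y\<close>, and
  \<open>insert x Y\<close> is again an infinite subset of the tail.\<close>

lemma far_shift:
  assumes "far X (\<lambda>Y. Q (s \<union> Y))"
  shows "\<exists>m. \<forall>x\<in>X. m \<le> x \<longrightarrow> far X (\<lambda>Y. Q (insert x s \<union> Y))"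
proof -
  obtain m where m: "\<And>Y. Y \<subseteq> X \<inter> {m..} \<Longrightarrow> infinite Y \<Longrightarrow> Q (s \<union> Y)" using assms by (elim farE) blast
  have "far X (\<lambda>Y. Q (insert x s \<union> Y))" if x: "x \<in> X" "m \<le> x" for x
  proof (rule farI[of _ m])
    fix Y assume "Y \<subseteq> X \<inter> {m..}" "infinite Y"
    then have "Q (s \<union> insert x Y)" using x by (intro m) auto
    then show "Q (insert x s \<union> Y)" by simp
  qed
  then show ?thesis by blast
qed

lemma settled_exists:
  assumes P: "\<And>k. is_open (P k)" and X: "infinite X"
  obtains X' where "X' \<subseteq> X" "settled P X'"
proof -
  define W where "W i = (case i of Inl k \<Rightarrow> P k | Inr (Inl b) \<Rightarrow> out_left P b | Inr (Inr b) \<Rightarrow> out_right P b)"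
    for i :: "nat + nat + nat"
  have "is_open (W i)" for i
    using P unfolding W_def out_left_def out_right_def by (auto split: sum.split intro: is_open_ex)
  then obtain X1 where X1: "X1 \<subseteq> X" "infinite X1"
    "\<And>s i. finite s \<Longrightarrow> \<exists>m. (\<forall>Y\<subseteq>X1 \<inter> {m..}. infinite Y \<longrightarrow> W i (s \<union> Y)) \<or>
       (\<forall>Y\<subseteq>X1 \<inter> {m..}. infinite Y \<longrightarrow> \<not> W i (s \<union> Y))"
    using nash_williams_family[OF _ X, of W] by metis
  have W: "far X1 (\<lambda>Y. W i (s \<union> Y)) \<or> far X1 (\<lambda>Y. \<not> W i (s \<union> Y))" if "finite s" for s i
    using X1(3)[OF that, of i] unfolding far_def by (elim exE disjE) (intro disjI1 exI, assumption, intro disjI2 exI, assumption)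
  define E where "E xsb x = large_odd (snd xsb) (forced_outputs P X1 (insert x (set (fst xsb))))" for xsb :: "nat list \<times> nat" and x
  define D where "D xsb Z \<longleftrightarrow> (\<forall>x\<in>Z. E xsb x) \<or> (\<forall>x\<in>Z. \<not> E xsb x)" for xsb Z
  obtain X2 where X2: "X2 \<subseteq> X1" "infinite X2" "\<And>xsb. \<exists>m. D xsb (X2 \<inter> {m..})"
  proof (rule diagonal_subset[of D X1])
    show "\<exists>X'\<subseteq>Z. infinite X' \<and> D xsb X'" if "infinite Z" for Z xsb
    proof -
      have "Z = {x \<in> Z. E xsb x} \<union> {x \<in> Z. \<not> E xsb x}" by blast
      then have "infinite {x \<in> Z. E xsb x} \<or> infinite {x \<in> Z. \<not> E xsb x}"
        using that by (metis finite_Un)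
      then show ?thesis
      proof
        assume "infinite {x \<in> Z. E xsb x}"
        then show ?thesis by (intro exI[of _ "{x \<in> Z. E xsb x}"]) (auto simp: D_def)
      next
        assume "infinite {x \<in> Z. \<not> E xsb x}"
        then show ?thesis by (intro exI[of _ "{x \<in> Z. \<not> E xsb x}"]) (auto simp: D_def)
      qed
    qed
    show "D xsb X'" if "D xsb Z" "X' \<subseteq> Z" for xsb Z X' using that unfolding D_def by blast
  qed (use X1(2) in auto)
  have W2: "far X2 (\<lambda>Y. W i (s \<union> Y)) \<or> far X2 (\<lambda>Y. \<not> W i (s \<union> Y))" if "finite s" for s i
    using W[OF that, of i] far_subset[OF _ X2(1)] by blast
  \<comment> \<open>Thinning does not change forced outputs: both alternatives of the dichotomy pass
    to subsets, and they exclude each other on an infinite set.\<close>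
  have v: "forced_outputs P X2 s = forced_outputs P X1 s" if "finite s" for s
  proof -
    have "far X2 (\<lambda>Y. P k (s \<union> Y)) \<longleftrightarrow> far X1 (\<lambda>Y. P k (s \<union> Y))" for k
      using W[OF that, of "Inl k"] far_subset[OF _ X2(1)] far_not[of X2 "\<lambda>Y. P k (s \<union> Y)"] X2(2)
      unfolding W_def by auto
    then show ?thesis unfolding forced_outputs_def by simp
  qed
  have "settled P X2"
    unfolding settled_def
  proof (intro conjI allI impI X2(2))
    fix s :: "nat set" and b :: nat assume s: "finite s"
    show "far X2 (\<lambda>Y. P b (s \<union> Y)) \<or> far X2 (\<lambda>Y. \<not> P b (s \<union> Y))"
      using W2[OF s, of "Inl b"] by (simp add: W_def)
    show "far X2 (\<lambda>Y. out_left P b (s \<union> Y)) \<or> far X2 (\<lambda>Y. \<not> out_left P b (s \<union> Y))"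
      using W2[OF s, of "Inr (Inl b)"] by (simp add: W_def)
    show "far X2 (\<lambda>Y. out_right P b (s \<union> Y)) \<or> far X2 (\<lambda>Y. \<not> out_right P b (s \<union> Y))"
      using W2[OF s, of "Inr (Inr b)"] by (simp add: W_def)
    obtain xs where "set xs = s" using finite_list[OF s] by blast
    then show "\<exists>m. (\<forall>x\<in>X2. m \<le> x \<longrightarrow> large_odd b (forced_outputs P X2 (insert x s))) \<or>
                 (\<forall>x\<in>X2. m \<le> x \<longrightarrow> \<not> large_odd b (forced_outputs P X2 (insert x s)))"
      using X2(3)[of "(xs, b)"] s unfolding D_def E_def by (fastforce simp: v)
  qed
  then show ?thesis using that[of X2] X1(1) X2(1) by blast
qed

text \<open>The threshold \<open>m\<close> depends on \<open>k\<close>. A far element may still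
  change the forced outputs, but only at ever larger numbers; \<open>always_new\<close> describes
  stems where this does happen.\<close>

lemma forced_outputs_insert_far:
  assumes X: "settled P X" and s: "finite s"
  shows "\<exists>m. \<forall>x\<in>X. m \<le> x \<longrightarrow> (k \<in> forced_outputs P X (insert x s) \<longleftrightarrow> k \<in> forced_outputs P X s)"
proof (cases "far X (\<lambda>Y. P k (s \<union> Y))")
  case True
  then show ?thesis using far_shift[OF True] unfolding forced_outputs_def by auto
next
  case False
  then have "far X (\<lambda>Y. \<not> P k (s \<union> Y))" using X s unfolding settled_def by blast
  from far_shift[of X "\<lambda>Z. \<not> P k Z", OF this] obtain m
    where m: "\<forall>x\<in>X. m \<le> x \<longrightarrow> far X (\<lambda>Y. \<not> P k (insert x s \<union> Y))" ..
  have "infinite X" using X unfolding settled_def by simp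
  then have "\<forall>x\<in>X. m \<le> x \<longrightarrow> \<not> far X (\<lambda>Y. P k (insert x s \<union> Y))"
    using m far_not[of X "\<lambda>Y. P k (insert x s \<union> Y)" for x] by auto
  then show ?thesis using False unfolding forced_outputs_def by auto
qed

lemma forced_outputs_insert_below:
  assumes X: "settled P X" and s: "finite s"
  shows "\<exists>m. \<forall>x\<in>X. m \<le> x \<longrightarrow> (\<forall>k<b. k \<in> forced_outputs P X (insert x s) \<longleftrightarrow> k \<in> forced_outputs P X s)"
proof (induction b)
  case (Suc b)
  then obtain m where "\<forall>x\<in>X. m \<le> x \<longrightarrow> (\<forall>k<b. k \<in> forced_outputs P X (insert x s) \<longleftrightarrow> k \<in> forced_outputs P X s)" ..
  moreover obtain m' where "\<forall>x\<in>X. m' \<le> x \<longrightarrow> (b \<in> forced_outputs P X (insert x s) \<longleftrightarrow> b \<in> forced_outputs P X s)"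
    using forced_outputs_insert_far[OF assms] by blast
  ultimately show ?case by (intro exI[of _ "max m m'"]) (auto simp: less_Suc_eq)
qed simp

lemma forced_outputs_stage:
  assumes "is_open (P k)" "P k (t \<union> Y)"
  shows "\<exists>u. k \<in> forced_outputs P X (t \<union> (Y \<inter> {..<u}))"
proof -
  obtain u where u: "\<And>Z. Z \<inter> {..<u} = (t \<union> Y) \<inter> {..<u} \<Longrightarrow> P k Z" using opnD[of "P k", OF assms] by blast
  have "P k (t \<union> (Y \<inter> {..<u}) \<union> Y')" if "Y' \<subseteq> X \<inter> {u..}" for Y'
    by (rule u) (use that in auto)
  then show ?thesis unfolding forced_outputs_def by (auto intro!: exI[of _ u] farI[of _ u])
qed

text \<open>First reach a stem \<open>t1\<close> that forces a left output \<open>z\<close>. If no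
  stem of \<open>T\<close> forcing \<open>z\<close> were \<open>always_new\<close>, one could walk
  through \<open>T\<close> from \<open>t1\<close> with no forced right output from a fixed
  \<open>b1\<close> on: those past the bound \<open>b2\<close> of the current stem do not appear,
  and those below \<open>b2\<close> do not change when the next element is far. The limit of the
  walk would have no right output from \<open>b1\<close> on, against \<open>R\<close>.\<close>

lemma always_new_stem_exists:
  assumes P: "\<And>k. is_open (P k)" and X: "settled P X"
    and t0: "t0 \<in> T" and fin: "\<And>t. t \<in> T \<Longrightarrow> finite t"
    and step: "\<And>t m. t \<in> T \<Longrightarrow> \<exists>x\<in>X. m \<le> x \<and> insert x t \<in> T"
    and L: "\<And>t b. t \<in> T \<Longrightarrow> far X (\<lambda>Y. out_left P b (t \<union> Y))"
    and R: "\<And>t b. t \<in> T \<Longrightarrow> far X (\<lambda>Y. out_right P b (t \<union> Y))"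
  obtains t z where "t \<in> T" "b \<le> z" "2 * z \<in> forced_outputs P X t" "always_new P X t"
proof -
  obtain m where m: "\<And>Y. Y \<subseteq> X \<inter> {m..} \<Longrightarrow> infinite Y \<Longrightarrow> out_left P b (t0 \<union> Y)" by (rule farE[OF L[OF t0, of b]]) blast
  obtain Y where Y: "Y \<subseteq> X \<inter> {m..}" "infinite Y" "\<And>u. t0 \<union> (Y \<inter> {..<u}) \<in> T"
    using chain_exists[OF t0 fin step] by metis
  obtain z where z: "b \<le> z" "P (2 * z) (t0 \<union> Y)" using m[OF Y(1,2)] unfolding out_left_def by blast
  obtain u where u: "2 * z \<in> forced_outputs P X (t0 \<union> (Y \<inter> {..<u}))" using forced_outputs_stage[of P "2 * z", OF P z(2)] by blast
  define t1 where "t1 = t0 \<union> (Y \<inter> {..<u})"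
  have t1: "t1 \<in> T" "2 * z \<in> forced_outputs P X t1" using Y(3) u unfolding t1_def by auto
  have "\<exists>t\<in>T. 2 * z \<in> forced_outputs P X t \<and> always_new P X t"
  proof (rule ccontr)
    assume a: "\<not> ?thesis"
    have bounded: "\<exists>b m. \<forall>x\<in>X. m \<le> x \<longrightarrow> \<not> large_odd b (forced_outputs P X (insert x t))"
      if "t \<in> T" "2 * z \<in> forced_outputs P X t" for t
    proof -
      have "\<not> always_new P X t" using a that by blast
      then obtain b where b: "\<nexists>m. \<forall>x\<in>X. m \<le> x \<longrightarrow> large_odd b (forced_outputs P X (insert x t))" unfolding always_new_def by blast
      have "\<exists>m. (\<forall>x\<in>X. m \<le> x \<longrightarrow> large_odd b (forced_outputs P X (insert x t))) \<or>
        (\<forall>x\<in>X. m \<le> x \<longrightarrow> \<not> large_odd b (forced_outputs P X (insert x t)))"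
        using X fin[OF that(1)] unfolding settled_def by blast
      with b show ?thesis by blast
    qed
    obtain b1 m1 where b1: "\<And>x. x \<in> X \<Longrightarrow> m1 \<le> x \<Longrightarrow> \<not> large_odd b1 (forced_outputs P X (insert x t1))"
      using bounded[OF t1] by blast
    define T' where "T' = {t \<in> T. 2 * z \<in> forced_outputs P X t \<and> \<not> large_odd b1 (forced_outputs P X t)}"
    have "\<not> large_odd b1 (forced_outputs P X t1)"
    proof
      assume "large_odd b1 (forced_outputs P X t1)"
      then obtain w where w: "b1 \<le> w" "Suc (2 * w) \<in> forced_outputs P X t1" unfolding large_odd_def by blast
      obtain m2 where m2: "\<forall>x\<in>X. m2 \<le> x \<longrightarrow> (Suc (2 * w) \<in> forced_outputs P X (insert x t1) \<longleftrightarrow> Suc (2 * w) \<in> forced_outputs P X t1)"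
        using forced_outputs_insert_far[OF X fin[OF t1(1)]] by blast
      obtain x where "x \<in> X" "max m1 m2 \<le> x" using X unfolding settled_def by (meson infinite_nat_iff_unbounded_le)
      then show False using m2 w b1[of x] unfolding large_odd_def by auto
    qed
    then have t1': "t1 \<in> T'" using t1 by (simp add: T'_def)
    have step': "\<exists>x\<in>X. m \<le> x \<and> insert x t \<in> T'" if t: "t \<in> T'" for t m
    proof -
      have tT: "t \<in> T" "2 * z \<in> forced_outputs P X t" "\<not> large_odd b1 (forced_outputs P X t)" using t by (auto simp: T'_def)
      obtain b2 m2 where b2: "\<And>x. x \<in> X \<Longrightarrow> m2 \<le> x \<Longrightarrow> \<not> large_odd b2 (forced_outputs P X (insert x t))"
        using bounded[OF tT(1,2)] by blast
      \<comment> \<open>The bound covers the codes \<open>Suc (2 * w)\<close> with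
        \<open>w < b2\<close> as well as the code \<open>2 * z\<close>.\<close>
      obtain m3 where m3: "\<forall>x\<in>X. m3 \<le> x \<longrightarrow> (\<forall>k<Suc (2 * max b2 z). k \<in> forced_outputs P X (insert x t) \<longleftrightarrow> k \<in> forced_outputs P X t)"
        using forced_outputs_insert_below[OF X fin[OF tT(1)]] by blast
      obtain x where x: "x \<in> X" "max m (max m2 m3) \<le> x" "insert x t \<in> T" using step[OF tT(1)] by blast
      have "2 * z \<in> forced_outputs P X (insert x t)" using m3 x tT(2) by auto
      moreover have "\<not> large_odd b1 (forced_outputs P X (insert x t))"
      proof
        assume "large_odd b1 (forced_outputs P X (insert x t))"
        then obtain w where w: "b1 \<le> w" "Suc (2 * w) \<in> forced_outputs P X (insert x t)" unfolding large_odd_def by blast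
        then have "w < b2" using b2[of x] x unfolding large_odd_def by (auto simp: not_le[symmetric])
        then have "Suc (2 * w) \<in> forced_outputs P X t" using m3 x w by auto
        then show False using tT(3) w(1) unfolding large_odd_def by blast
      qed
      ultimately show ?thesis using x by (auto simp: T'_def)
    qed
    obtain m where m: "\<And>Y. Y \<subseteq> X \<inter> {m..} \<Longrightarrow> infinite Y \<Longrightarrow> out_right P b1 (t1 \<union> Y)"
      by (rule farE[OF R[OF t1(1), of b1]]) blast
    have fin': "\<And>t. t \<in> T' \<Longrightarrow> finite t" using fin by (simp add: T'_def)
    obtain Y where Y: "Y \<subseteq> X \<inter> {m..}" "infinite Y" "\<And>u. t1 \<union> (Y \<inter> {..<u}) \<in> T'"
      using chain_exists[OF t1' fin' step'] by metis
    obtain w where w: "b1 \<le> w" "P (Suc (2 * w)) (t1 \<union> Y)" using m[OF Y(1,2)] unfolding out_right_def by blast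
    obtain u where "Suc (2 * w) \<in> forced_outputs P X (t1 \<union> (Y \<inter> {..<u}))" using forced_outputs_stage[of P "Suc (2 * w)", OF P w(2)] by blast
    then show False using Y(3)[of u] w(1) unfolding T'_def large_odd_def by blast
  qed
  then show ?thesis using that z(1) by blast
qed

subsection \<open>Conditions\<close>

text \<open>A condition \<open>(n, g, l)\<close> fixes the colouring to be \<open>g\<close> on pairs below \<open>n\<close> and promises the value
  \<open>l x\<close> on all pairs \<open>(x, y)\<close> with \<open>x < n \<le> y\<close>; a weak extension may break the latter promise.\<close>

type_synonym cond = "nat \<times> (nat \<Rightarrow> nat \<Rightarrow> bool) \<times> (nat \<Rightarrow> bool)"

abbreviation len :: "cond \<Rightarrow> nat" where "len p \<equiv> fst p"
abbreviation col :: "cond \<Rightarrow> nat \<Rightarrow> nat \<Rightarrow> bool" where "col p \<equiv> fst (snd p)"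
abbreviation limval :: "cond \<Rightarrow> nat \<Rightarrow> bool" where "limval p \<equiv> snd (snd p)"

definition agrees :: "cond \<Rightarrow> (nat \<Rightarrow> nat \<Rightarrow> bool) \<Rightarrow> bool" where
  "agrees p f \<longleftrightarrow> (\<forall>x y. x < y \<and> y < len p \<longrightarrow> f x y = col p x y)"

definition cyl :: "cond \<Rightarrow> (nat \<Rightarrow> nat \<Rightarrow> bool) set" where
  "cyl p = {f. agrees p f \<and> (\<forall>x y. x < len p \<and> len p \<le> y \<longrightarrow> f x y = limval p x)}"

definition weak_extends :: "cond \<Rightarrow> cond \<Rightarrow> bool" where
  "weak_extends r q \<longleftrightarrow> len q \<le> len r \<and> (\<forall>x<len q. limval r x = limval q x) \<and>
     (\<forall>x y. x < y \<and> y < len q \<longrightarrow> col r x y = col q x y)"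

definition extends :: "cond \<Rightarrow> cond \<Rightarrow> bool" where
  "extends r q \<longleftrightarrow> weak_extends r q \<and> (\<forall>x y. x < len q \<and> len q \<le> y \<and> y < len r \<longrightarrow> col r x y = limval q x)"

lemma weak_extends_refl: "weak_extends p p"
  by (simp add: weak_extends_def)

lemma weak_extends_trans: "weak_extends r q \<Longrightarrow> weak_extends q p \<Longrightarrow> weak_extends r p"
  by (simp add: weak_extends_def)

lemma extends_refl: "extends p p"
  by (auto simp: extends_def weak_extends_refl)

lemma extends_weak: "extends r q \<Longrightarrow> weak_extends r q"
  by (simp add: extends_def)

lemma extends_len: "extends r q \<Longrightarrow> len q \<le> len r"
  by (simp add: extends_def weak_extends_def)

lemma extends_limval: "extends r q \<Longrightarrow> x < len q \<Longrightarrow> limval r x = limval q x"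
  by (simp add: extends_def weak_extends_def)

lemma extends_trans:
  assumes "extends r q" "extends q p" shows "extends r p"
  unfolding extends_def
proof (intro conjI allI impI)
  show "weak_extends r p" using assms weak_extends_trans[of r q p] by (simp add: extends_def)
  fix x y assume a: "x < len p \<and> len p \<le> y \<and> y < len r"
  show "col r x y = limval p x"
  proof (cases "y < len q")
    case True
    then have "col r x y = col q x y" using assms(1) a by (simp add: extends_def weak_extends_def)
    then show ?thesis using assms(2) a True by (simp add: extends_def)
  next
    case False
    then have "col r x y = limval q x" using assms a extends_len[OF assms(2)] by (simp add: extends_def)
    then show ?thesis using assms(2) a by (simp add: extends_def weak_extends_def)
  qed
qed

lemma agrees_weak_extends: "agrees r f \<Longrightarrow> weak_extends r q \<Longrightarrow> agrees q f"
  by (simp add: agrees_def weak_extends_def)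

lemma cyl_agrees: "f \<in> cyl p \<Longrightarrow> agrees p f"
  by (simp add: cyl_def)

lemma cyl_extends:
  assumes "extends r q" shows "cyl r \<subseteq> cyl q"
proof
  fix f assume f: "f \<in> cyl r"
  show "f \<in> cyl q" unfolding cyl_def
  proof (intro CollectI conjI allI impI)
    show "agrees q f" using agrees_weak_extends[OF cyl_agrees[OF f] extends_weak[OF assms]] .
  next
    fix x y assume xy: "x < len q \<and> len q \<le> y"
    have l: "len q \<le> len r" using assms by (rule extends_len)
    show "f x y = limval q x"
    proof (cases "y < len r")
      case True
      then have "f x y = col r x y" using f xy by (simp add: cyl_def agrees_def)
      then show ?thesis using assms xy True by (simp add: extends_def)
    next
      case False
      then have "f x y = limval r x" using f xy l by (simp add: cyl_def)
      then show ?thesis using extends_limval[OF assms] xy by simp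
    qed
  qed
qed

text \<open>Columns from \<open>len q\<close> on have not been promised anything, so their limits
  can be prescribed by \<open>h\<close>.\<close>

lemma extends_exists:
  obtains r where "extends r q" "m \<le> len r" "\<And>x. len q \<le> x \<Longrightarrow> limval r x = h x"
proof (rule that)
  let ?r = "(max m (len q), \<lambda>x y. if y < len q then col q x y else limval q x, \<lambda>x. if x < len q then limval q x else h x)"
  show "extends ?r q" "m \<le> len ?r" "\<And>x. len q \<le> x \<Longrightarrow> limval ?r x = h x"
    by (auto simp: extends_def weak_extends_def)
qed

lemma cyl_nonempty: "\<exists>f. f \<in> cyl p"
  by (rule exI[of _ "\<lambda>x y. if y < len p then col p x y else limval p x"]) (simp add: cyl_def agrees_def)

lemma extends_along:
  assumes "f \<in> cyl q"
  obtains r where "extends r q" "m \<le> len r" "agrees r f"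
proof (rule that)
  let ?r = "(max m (len q), f, limval q)"
  show "extends ?r q" "m \<le> len ?r" "agrees ?r f"
    using assms by (auto simp: extends_def weak_extends_def cyl_def agrees_def)
qed

subsection \<open>Diagonalising against p-homogeneous sets\<close>

lemma join_elem_div2: "k \<in> join L R \<Longrightarrow> k div 2 \<in> L \<or> k div 2 \<in> R"
  by (auto simp: join_def)

lemma p_homogeneousE:
  assumes "p_homogeneous f K"
  obtains L R c where "K = join L R" "infinite L" "infinite R"
    "\<And>x y. x \<in> L \<Longrightarrow> y \<in> R \<Longrightarrow> x \<noteq> y \<Longrightarrow> f (min x y) (max x y) = c"
  using assms unfolding p_homogeneous_def
proof (elim exE conjE)
  fix L R c
  assume "K = join L R" "infinite L" "infinite R" "\<forall>x\<in>L. \<forall>y\<in>R. x \<noteq> y \<longrightarrow> f (min x y) (max x y) = c"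
  then show thesis by (intro that[of L R c]) simp_all
qed

text \<open>\<open>k div 2\<close> is the number that \<open>k\<close> codes, in whichever half. The
  opposite half is infinite, so it has elements past \<open>len p\<close>, where \<open>f\<close>
  takes the promised limit.\<close>

lemma p_homogeneous_lim:
  assumes h: "p_homogeneous f K" and f: "f \<in> cyl p"
    and k: "k \<in> K" "k' \<in> K" "k div 2 < len p" "k' div 2 < len p"
  shows "limval p (k div 2) = limval p (k' div 2)"
proof -
  obtain L R c where K: "K = join L R" and inf: "infinite L" "infinite R"
    and c: "\<And>x y. x \<in> L \<Longrightarrow> y \<in> R \<Longrightarrow> x \<noteq> y \<Longrightarrow> f (min x y) (max x y) = c"
    by (rule p_homogeneousE[OF h]) blast
  have "limval p i = c" if "i \<in> L \<or> i \<in> R" "i < len p" for i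
    using that(1)
  proof
    assume i: "i \<in> L"
    obtain y where "y \<in> R" "len p \<le> y" using inf(2) unfolding infinite_nat_iff_unbounded_le by blast
    then show ?thesis using c[OF i, of y] f that(2) by (simp add: cyl_def min_def max_def split: if_splits)
  next
    assume i: "i \<in> R"
    obtain y where "y \<in> L" "len p \<le> y" using inf(1) unfolding infinite_nat_iff_unbounded_le by blast
    then show ?thesis using c[OF _ i, of y] f that(2) by (simp add: cyl_def min_def max_def split: if_splits)
  qed
  then show ?thesis using join_elem_div2[of k L R] join_elem_div2[of k' L R] k unfolding K by simp
qed

lemma p_homogeneous_pair:
  assumes h: "p_homogeneous f K" and f: "f \<in> cyl p"
    and k: "2 * z \<in> K" "Suc (2 * w) \<in> K" and zw: "z < w" "w < len p"
  shows "col p z w = limval p z"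
proof -
  obtain L R c where K: "K = join L R" and inf: "infinite L" "infinite R"
    and c: "\<And>x y. x \<in> L \<Longrightarrow> y \<in> R \<Longrightarrow> x \<noteq> y \<Longrightarrow> f (min x y) (max x y) = c"
    by (rule p_homogeneousE[OF h]) blast
  obtain y where y: "y \<in> R" "len p \<le> y" using inf(2) unfolding infinite_nat_iff_unbounded_le by blast
  have z: "z \<in> L" "w \<in> R" using k unfolding K by auto
  have "limval p z = c" using c[OF z(1) y(1)] y(2) f zw by (simp add: cyl_def min_def max_def)
  moreover have "col p z w = c" using c[OF z] f zw by (simp add: cyl_def agrees_def min_def max_def)
  ultimately show ?thesis by simp
qed

text \<open>All colourings and all continuations that are still possible are covered, so a defeat is
  permanent (\<open>defeats_mono\<close>) and applies to the final colouring and the final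
  set.\<close>

definition defeats :: "(nat \<Rightarrow> nat set \<Rightarrow> bool) \<Rightarrow> cond \<Rightarrow> nat set \<Rightarrow> nat set \<Rightarrow> bool" where
  "defeats P p s X \<longleftrightarrow> (\<forall>f\<in>cyl p. \<forall>Y\<subseteq>X. infinite Y \<longrightarrow> \<not> p_homogeneous f {k. P k (s \<union> Y)})"

lemma defeats_mono:
  assumes "defeats P p s X" "extends p' p" "s \<subseteq> s'" "s' \<subseteq> s \<union> X" "X' \<subseteq> X"
  shows "defeats P p' s' X'"
  unfolding defeats_def
proof (intro ballI allI impI)
  fix f Y assume f: "f \<in> cyl p'" and Y: "Y \<subseteq> X'" "infinite Y"
  have "s' \<union> Y = s \<union> ((s' - s) \<union> Y)" using assms(3) by blast
  moreover have "(s' - s) \<union> Y \<subseteq> X" "infinite ((s' - s) \<union> Y)" using assms(4,5) Y by auto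
  moreover have "f \<in> cyl p" using f cyl_extends[OF assms(2)] by blast
  ultimately show "\<not> p_homogeneous f {k. P k (s' \<union> Y)}" using assms(1) unfolding defeats_def by auto
qed

lemma defeats_if_far:
  assumes "far X (\<lambda>Y. \<forall>f\<in>cyl p. \<not> p_homogeneous f {k. P k (s \<union> Y)})"
  shows "\<exists>m. defeats P p s (X \<inter> {m..})"
proof -
  obtain m where m: "\<And>Y. Y \<subseteq> X \<inter> {m..} \<Longrightarrow> infinite Y \<Longrightarrow> \<forall>f\<in>cyl p. \<not> p_homogeneous f {k. P k (s \<union> Y)}"
    by (rule farE[OF assms]) blast
  have "defeats P p s (X \<inter> {m..})" unfolding defeats_def using m by simp
  then show ?thesis ..
qed

lemma defeats_lim:
  assumes "k \<in> forced_outputs P X s" "k' \<in> forced_outputs P X s" "k div 2 < len p" "k' div 2 < len p"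
    "limval p (k div 2) \<noteq> limval p (k' div 2)"
  shows "\<exists>m. defeats P p s (X \<inter> {m..})"
proof (rule defeats_if_far, rule far_mp)
  show "far X (\<lambda>Y. P k (s \<union> Y) \<and> P k' (s \<union> Y))" using assms(1,2) by (auto simp: forced_outputs_def intro: far_conj)
  show "\<forall>f\<in>cyl p. \<not> p_homogeneous f {k. P k (s \<union> Y)}" if "P k (s \<union> Y) \<and> P k' (s \<union> Y)" for Y
    using p_homogeneous_lim[of _ "{k. P k (s \<union> Y)}" p k k'] that assms(3-) by auto
qed

lemma defeats_pair:
  assumes "2 * z \<in> forced_outputs P X s" "Suc (2 * w) \<in> forced_outputs P X s" "z < w" "w < len p" "col p z w \<noteq> limval p z"
  shows "\<exists>m. defeats P p s (X \<inter> {m..})"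
proof (rule defeats_if_far, rule far_mp)
  show "far X (\<lambda>Y. P (2 * z) (s \<union> Y) \<and> P (Suc (2 * w)) (s \<union> Y))"
    using assms(1,2) by (auto simp: forced_outputs_def intro: far_conj)
  show "\<forall>f\<in>cyl p. \<not> p_homogeneous f {k. P k (s \<union> Y)}" if "P (2 * z) (s \<union> Y) \<and> P (Suc (2 * w)) (s \<union> Y)" for Y
    using p_homogeneous_pair[of _ "{k. P k (s \<union> Y)}" p z w] that assms(3-) by auto
qed

lemma p_homogeneous_out_left_out_right:
  assumes "p_homogeneous f {k. P k Z}" shows "out_left P b Z" "out_right P b Z"
proof -
  obtain L R where K: "{k. P k Z} = join L R" and inf: "infinite L" "infinite R"
    by (rule p_homogeneousE[OF assms]) blast
  obtain z w where "z \<in> L" "w \<in> R" "b \<le> z" "b \<le> w" using inf unfolding infinite_nat_iff_unbounded_le by blast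
  moreover from this have "2 * z \<in> {k. P k Z}" "Suc (2 * w) \<in> {k. P k Z}" unfolding K by auto
  ultimately show "out_left P b Z" "out_right P b Z" unfolding out_left_def out_right_def by auto
qed

text \<open>Were the outputs in one half bounded for all continuations in a tail, none of them could
  give a p-homogeneous set and a tail would be defeated. The dichotomies in \<open>settled\<close>
  turn the failure of this into a positive statement.\<close>

lemma not_defeats_far:
  assumes X: "settled P X" and s: "finite s" and "\<And>m. \<not> defeats P p s (X \<inter> {m..})"
  shows "far X (\<lambda>Y. out_left P b (s \<union> Y))" "far X (\<lambda>Y. out_right P b (s \<union> Y))"
proof -
  have "\<not> far X (\<lambda>Y. \<not> out_left P b (s \<union> Y))"
  proof
    assume "far X (\<lambda>Y. \<not> out_left P b (s \<union> Y))"
    then have "far X (\<lambda>Y. \<forall>f\<in>cyl p. \<not> p_homogeneous f {k. P k (s \<union> Y)})"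
      by (rule far_mp) (use p_homogeneous_out_left_out_right(1) in blast)
    then show False using defeats_if_far assms(3) by blast
  qed
  moreover have "\<not> far X (\<lambda>Y. \<not> out_right P b (s \<union> Y))"
  proof
    assume "far X (\<lambda>Y. \<not> out_right P b (s \<union> Y))"
    then have "far X (\<lambda>Y. \<forall>f\<in>cyl p. \<not> p_homogeneous f {k. P k (s \<union> Y)})"
      by (rule far_mp) (use p_homogeneous_out_left_out_right(2) in blast)
    then show False using defeats_if_far assms(3) by blast
  qed
  ultimately show "far X (\<lambda>Y. out_left P b (s \<union> Y))" "far X (\<lambda>Y. out_right P b (s \<union> Y))"
    using X s unfolding settled_def by blast+
qed

section \<open>Stems with reservoirs (Mathias conditions) and forcing for a partially computed
  colouring\<close>

definition stem :: "nat set \<Rightarrow> nat set \<Rightarrow> bool" where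
  "stem s X \<longleftrightarrow> finite s \<and> infinite X \<and> (\<forall>a\<in>s. \<forall>x\<in>X. a < x)"

definition stem_extends :: "nat set \<Rightarrow> nat set \<Rightarrow> nat set \<Rightarrow> nat set \<Rightarrow> bool" where
  "stem_extends s X s' X' \<longleftrightarrow> s \<subseteq> s' \<and> s' \<subseteq> s \<union> X \<and> X' \<subseteq> X \<and> stem s' X'"

lemma stem_extends_trans: "stem_extends s X s' X' \<Longrightarrow> stem_extends s' X' s'' X'' \<Longrightarrow> stem_extends s X s'' X''"
  unfolding stem_extends_def by blast

lemma stem_extends_refl: "stem s X \<Longrightarrow> stem_extends s X s X"
  unfolding stem_extends_def by blast

lemma pick_above:
  assumes "infinite X" "finite t"
  obtains x :: nat where "x \<in> X" "m \<le> x" "\<And>a. a \<in> t \<Longrightarrow> a < x"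
proof -
  from assms(2) obtain b where "\<forall>a\<in>t. a < b" unfolding finite_nat_set_iff_bounded ..
  moreover obtain x where "x \<in> X" "max b m \<le> x" using assms(1) unfolding infinite_nat_iff_unbounded_le by blast
  ultimately show ?thesis using that[of x] by fastforce
qed

lemma tail_tail: "X \<inter> {m..} \<inter> {n..} = X \<inter> {max m n::nat..}"
  by auto

text \<open>\<open>F f x s b\<close> is read as: the functional that should compute
  \<open>f'\<close> from \<open>f\<close> halts on the pair \<open>(x, s)\<close> with colour
  \<open>b\<close>. Determinism and finite use are all that the forcing argument takes from
  computability.\<close>

locale partial_coloring =
  fixes F :: "(nat \<Rightarrow> nat \<Rightarrow> bool) \<Rightarrow> nat \<Rightarrow> nat \<Rightarrow> bool \<Rightarrow> bool"
  assumes F_det: "F f x s b \<Longrightarrow> F f x s b' \<Longrightarrow> b' = b"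
    and F_use: "F f x s b \<Longrightarrow> \<exists>u. \<forall>f'. (\<forall>i j. i < j \<and> j < u \<longrightarrow> f' i j = f i j) \<longrightarrow> F f' x s b"
begin

text \<open>Stated over \<open>agrees\<close> and not over \<open>cyl\<close>: a halting computation
  sees finitely many pairs, so it is unaffected when promised limits are broken later.\<close>

definition decides :: "cond \<Rightarrow> nat \<Rightarrow> nat \<Rightarrow> bool \<Rightarrow> bool" where
  "decides p x s b \<longleftrightarrow> (\<forall>f. agrees p f \<longrightarrow> F f x s b)"

text \<open>Since \<open>F\<close> is partial, limits are forced negatively: the opposite colour never appears.\<close>

definition forces_lim :: "cond \<Rightarrow> nat \<Rightarrow> bool \<Rightarrow> nat \<Rightarrow> bool" where
  "forces_lim p x c N \<longleftrightarrow> (\<forall>f\<in>cyl p. \<forall>s\<ge>N. \<not> F f x s (\<not> c))"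

text \<open>A density statement. When it fails, some extension is \<open>never_stable\<close>, which
  the construction of \<open>f\<close> excludes for a total stable \<open>f'\<close>.\<close>

definition live :: "cond \<Rightarrow> bool" where
  "live p \<longleftrightarrow> (\<forall>q. extends q p \<longrightarrow> (\<forall>x s. \<exists>r b. extends r q \<and> decides r x s b) \<and> (\<forall>x. \<exists>r c N. extends r q \<and> forces_lim r x c N))"

text \<open>Increasing p-homogeneity with colour \<open>c\<close>, put negatively because
  \<open>F\<close> is partial. Every element of \<open>X\<close> is treated as a future right
  element, so only new left elements will need forcing.\<close>

definition legal :: "bool \<Rightarrow> cond \<Rightarrow> nat set \<Rightarrow> nat set \<Rightarrow> bool" where
  "legal c p s X \<longleftrightarrow> (\<forall>x\<in>ev s. \<forall>y\<in>od s \<union> X. x < y \<longrightarrow> (\<forall>f\<in>cyl p. \<not> F f x y (\<not> c)))"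

text \<open>Every far \<open>e\<close> has a witness \<open>w\<close> whose limit, once chosen to be \<open>a\<close>, rules out the
  limit \<open>c\<close> for \<open>e\<close>.\<close>

definition promise :: "cond \<Rightarrow> nat set \<Rightarrow> bool \<Rightarrow> bool" where
  "promise p X c \<longleftrightarrow> (\<exists>a. \<forall>b. \<exists>m. \<forall>e\<in>X. m \<le> e \<longrightarrow>
     (\<exists>w\<ge>b. \<forall>q N. extends q p \<and> w < len q \<and> limval q w = a \<longrightarrow> \<not> forces_lim q e c N))"

lemma decide:
  assumes "f \<in> cyl q" "F f x s b"
  obtains r where "extends r q" "decides r x s b" "agrees r f"
proof -
  from F_use[OF assms(2)] obtain u where u: "\<forall>f'. (\<forall>i j. i < j \<and> j < u \<longrightarrow> f' i j = f i j) \<longrightarrow> F f' x s b" ..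
  obtain r where r: "extends r q" "u \<le> len r" "agrees r f" using extends_along[OF assms(1)] by blast
  have "F f' x s b" if "agrees r f'" for f'
    by (rule u[THEN spec, THEN mp]) (use r(2,3) that in \<open>simp add: agrees_def\<close>)
  then show ?thesis using that[of r] r by (simp add: decides_def)
qed

lemma decides_mono: "decides q x s b \<Longrightarrow> weak_extends r q \<Longrightarrow> decides r x s b"
  using agrees_weak_extends by (auto simp: decides_def)

lemma forces_lim_mono: "forces_lim q x c N \<Longrightarrow> extends r q \<Longrightarrow> N \<le> N' \<Longrightarrow> forces_lim r x c N'"
  using cyl_extends unfolding forces_lim_def by (meson order_trans subsetD)

lemma live_mono: "live p \<Longrightarrow> extends q p \<Longrightarrow> live q"
  using extends_trans unfolding live_def by blast

lemma legal_mono: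
  assumes "legal c p s X" "extends q p" "X' \<subseteq> X" shows "legal c q s X'"
  unfolding legal_def
proof (intro ballI impI)
  fix x y f assume a: "x \<in> ev s" "y \<in> od s \<union> X'" "x < y" "f \<in> cyl q"
  then have "f \<in> cyl p" "y \<in> od s \<union> X" using cyl_extends[OF assms(2)] assms(3) by auto
  then show "\<not> F f x y (\<not> c)" using a assms(1) unfolding legal_def by blast
qed

lemma promise_mono:
  assumes "promise p X c" "extends q p" "X' \<subseteq> X" shows "promise q X' c"
proof -
  obtain a where a: "\<And>b. \<exists>m. \<forall>e\<in>X. m \<le> e \<longrightarrow>
     (\<exists>w\<ge>b. \<forall>q N. extends q p \<and> w < len q \<and> limval q w = a \<longrightarrow> \<not> forces_lim q e c N)"
    using assms(1) unfolding promise_def by blast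
  have "\<exists>m. \<forall>e\<in>X'. m \<le> e \<longrightarrow> (\<exists>w\<ge>b. \<forall>r N. extends r q \<and> w < len r \<and> limval r w = a \<longrightarrow> \<not> forces_lim r e c N)" for b
  proof -
    obtain m where m: "\<And>e. e \<in> X \<Longrightarrow> m \<le> e \<Longrightarrow>
      (\<exists>w\<ge>b. \<forall>q N. extends q p \<and> w < len q \<and> limval q w = a \<longrightarrow> \<not> forces_lim q e c N)" using a by blast
    have "\<exists>w\<ge>b. \<forall>r N. extends r q \<and> w < len r \<and> limval r w = a \<longrightarrow> \<not> forces_lim r e c N" if "e \<in> X'" "m \<le> e" for e
      using m[of e] that assms(3) extends_trans[OF _ assms(2)] by blast
    then show ?thesis by blast
  qed
  then show ?thesis unfolding promise_def by blast
qed

text \<open>The forced limit controls the pairs of \<open>x\<close> only from \<open>N\<close> on,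
  so the reservoir is cut there.\<close>

lemma legal_insert_even:
  assumes l: "legal c q t X" and x: "\<And>a. a \<in> t \<Longrightarrow> a < x" and forces_lim: "forces_lim q x c N" and even: "even (card t)"
  shows "legal c q (insert x t) (X \<inter> {N..})"
  unfolding legal_def
proof (intro ballI impI)
  fix i j f assume a: "i \<in> ev (insert x t)" "j \<in> od (insert x t) \<union> X \<inter> {N..}" "i < j" "f \<in> cyl q"
  have "ev (insert x t) = insert x (ev t)" "od (insert x t) = od t" using ev_insert[of t x] x even by simp_all
  then have i: "i = x \<or> i \<in> ev t" and j: "j \<in> od t \<or> j \<in> X \<and> N \<le> j" using a by auto
  show "\<not> F f i j (\<not> c)"
  proof (cases "i = x")
    case True
    then have "j \<notin> t" using x a(3) by (metis less_asym')
    then show ?thesis using j ev_subset(2) forces_lim True a(4) unfolding forces_lim_def by blast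
  next
    case False
    then show ?thesis using i j a l unfolding legal_def by blast
  qed
qed

text \<open>A right element costs nothing: \<open>legal\<close> already speaks of every
  \<open>y \<in> X\<close>.\<close>

lemma legal_insert_odd:
  assumes l: "legal c q t X" and x: "\<And>a. a \<in> t \<Longrightarrow> a < x" "x \<in> X" and odd: "odd (card t)"
  shows "legal c q (insert x t) X"
proof -
  have "ev (insert x t) = ev t" "od (insert x t) = insert x (od t)" using ev_insert[of t x] x odd by simp_all
  then show ?thesis using l x(2) unfolding legal_def by auto
qed

text \<open>A tail of \<open>X1\<close> need not lie above \<open>t\<close>, nor past the cut
  \<open>N\<close> that legality asks for; cutting further repairs both and preserves
  \<open>defeats\<close>.\<close>

lemma not_defeats_tail:
  assumes no: "\<And>s' X'. stem_extends s X s' X' \<Longrightarrow> legal c q s' X' \<Longrightarrow> \<not> defeats P q s' X'"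
    and X1: "X1 \<subseteq> X" "infinite X1" and t: "s \<subseteq> t" "t \<subseteq> s \<union> X1" "finite t"
    and l: "legal c q t (X1 \<inter> {N..})"
  shows "\<not> defeats P q t (X1 \<inter> {m..})"
proof
  assume defeats: "defeats P q t (X1 \<inter> {m..})"
  from t(3) obtain b where b: "\<forall>a\<in>t. a < b" unfolding finite_nat_set_iff_bounded ..
  define X' where "X' = X1 \<inter> {max b (max m N)..}"
  have sub: "X' \<subseteq> X1 \<inter> {m..}" "X' \<subseteq> X1 \<inter> {N..}" by (auto simp: X'_def)
  have "stem t X'" unfolding stem_def using t(3) infinite_tail[OF X1(2)] b by (fastforce simp: X'_def)
  then have "stem_extends s X t X'" using t X1 sub unfolding stem_extends_def by blast
  moreover have "legal c q t X'" using legal_mono[OF l extends_refl sub(2)] .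
  moreover have "defeats P q t X'" using defeats_mono[OF defeats extends_refl _ _ sub(1)] by blast
  ultimately show False using no by blast
qed

end

section \<open>The two strategies: defeat a functional or obtain a promise, and spend a promise on
  the other colour\<close>

context partial_coloring
begin

text \<open>Take a stem with a forced left output \<open>z\<close> whose limit is decided, and a
  next element that releases a new right output \<open>w\<close>. Giving \<open>w\<close> the
  opposite limit would defeat \<open>P\<close>, unless the element that releases \<open>w\<close>
  can then no longer be forced to the \<open>f'\<close>-limit \<open>c\<close>. This obstruction,
  for all far elements, is the promise.\<close>

lemma defeats_or_promise:
  assumes P: "\<And>k. is_open (P k)" and l: "legal c p s X" and st: "stem s X"
  shows "\<exists>q s' X'. extends q p \<and> stem_extends s X s' X' \<and> legal c q s' X' \<and> (defeats P q s' X' \<or> promise q X' c)"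
proof (rule ccontr)
  assume no: "\<not> ?thesis"
  have no_defeats: "\<not> defeats P q s' X'" and no_promise: "\<not> promise q X' c"
    if "extends q p" "stem_extends s X s' X'" "legal c q s' X'" for q s' X'
    using no that by blast+
  have infX: "infinite X" and fs: "finite s" using st by (auto simp: stem_def)
  obtain X1 where X1: "X1 \<subseteq> X" and set: "settled P X1" using settled_exists[of P, OF P infX] by blast
  have inf: "infinite X1" using set by (simp add: settled_def)
  have tail: "\<not> defeats P q t (X1 \<inter> {m..})"
    if "extends q p" "s \<subseteq> t" "t \<subseteq> s \<union> X1" "finite t" "legal c q t (X1 \<inter> {N..})" for q t N m
    by (rule not_defeats_tail[OF no_defeats[OF that(1)] X1 inf that(2-5)])
  have side_available: "\<exists>e\<in>X1. m \<le> e \<and> (\<exists>r N. extends r q \<and> forces_lim r e c N)" if q: "extends q p" for q m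
  proof (rule ccontr)
    assume n: "\<not> ?thesis"
    let ?X = "X1 \<inter> {m..}"
    have sub: "?X \<subseteq> X" using X1 by blast
    \<comment> \<open>A vacuous promise: no far \<open>e\<close> can be forced to limit
      \<open>c\<close> below \<open>q\<close>, so any \<open>a\<close> and any \<open>w\<close> will
      do.\<close>
    have "promise q ?X c" unfolding promise_def
    proof (rule exI[of _ True], rule allI, rule exI[of _ 0], intro ballI impI)
      fix b e assume "e \<in> ?X"
      then have "\<not> forces_lim r e c N" if "extends r q" for r N using n that by blast
      then show "\<exists>w\<ge>b. \<forall>r N. extends r q \<and> w < len r \<and> limval r w = True \<longrightarrow> \<not> forces_lim r e c N" by blast
    qed
    moreover have "stem_extends s X s ?X" using st sub infinite_tail[OF inf] unfolding stem_extends_def stem_def by blast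
    ultimately show False using no_promise[OF q] legal_mono[OF l q sub] by blast
  qed
  \<comment> \<open>Different stems may be witnessed by incompatible conditions. This is harmless,
    because \<open>P\<close> and the forced outputs do not refer to \<open>f\<close>.\<close>
  define T where "T = {t. \<exists>q N. extends q p \<and> s \<subseteq> t \<and> t \<subseteq> s \<union> X1 \<and> finite t \<and> legal c q t (X1 \<inter> {N..})}"
  have s: "s \<in> T" unfolding T_def
    using fs legal_mono[OF l extends_refl, of "X1 \<inter> {0..}"] X1 extends_refl[of p] by blast
  have fin: "finite t" if "t \<in> T" for t using that unfolding T_def by blast
  have step: "\<exists>x\<in>X1. m \<le> x \<and> insert x t \<in> T" if "t \<in> T" for t m
  proof -
    obtain q N where q: "extends q p" "s \<subseteq> t" "t \<subseteq> s \<union> X1" "finite t" "legal c q t (X1 \<inter> {N..})"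
      using \<open>t \<in> T\<close> unfolding T_def by blast
    from q(4) obtain b where b: "\<forall>a\<in>t. a < b" unfolding finite_nat_set_iff_bounded ..
    show ?thesis
    proof (cases "even (card t)")
      case True
      obtain e r M where e: "e \<in> X1" "max b m \<le> e" "extends r q" "forces_lim r e c M" using side_available[OF q(1)] by blast
      have "legal c r (insert e t) (X1 \<inter> {N..} \<inter> {M..})"
        by (rule legal_insert_even[OF legal_mono[OF q(5) e(3) order_refl] _ e(4) True]) (use b e(2) in fastforce)
      then have "insert e t \<in> T" unfolding T_def tail_tail
        using q e extends_trans[OF e(3) q(1)] by blast
      then show ?thesis using e by auto
    next
      case False
      obtain x where x: "x \<in> X1" "max N (max b m) \<le> x" using inf unfolding infinite_nat_iff_unbounded_le by blast
      have "legal c q (insert x t) (X1 \<inter> {N..})"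
        by (rule legal_insert_odd[OF q(5) _ _ False]) (use b x in fastforce)+
      then have "insert x t \<in> T" unfolding T_def using q x by blast
      then show ?thesis using x by auto
    qed
  qed
  have QLR: "far X1 (\<lambda>Y. out_left P b (t \<union> Y))" "far X1 (\<lambda>Y. out_right P b (t \<union> Y))" if "t \<in> T" for t b
  proof -
    obtain q N where q: "extends q p" "s \<subseteq> t" "t \<subseteq> s \<union> X1" "finite t" "legal c q t (X1 \<inter> {N..})"
      using \<open>t \<in> T\<close> unfolding T_def by blast
    show "far X1 (\<lambda>Y. out_left P b (t \<union> Y))" "far X1 (\<lambda>Y. out_right P b (t \<union> Y))"
      using not_defeats_far[OF set q(4) tail[OF q]] by blast+
  qed
  obtain t z where t: "t \<in> T" "2 * z \<in> forced_outputs P X1 t" "always_new P X1 t"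
    using always_new_stem_exists[of P, OF P set s fin step QLR, of 0] by metis
  obtain q0 N where q0: "extends q0 p" "s \<subseteq> t" "t \<subseteq> s \<union> X1" "finite t" "legal c q0 t (X1 \<inter> {N..})"
    using t(1) unfolding T_def by blast
  from q0(4) obtain bt where bt: "\<forall>a\<in>t. a < bt" unfolding finite_nat_set_iff_bounded ..
  obtain q where q': "extends q q0" "Suc z \<le> len q" using extends_exists[of q0 "Suc z"] by metis
  have q: "extends q p" "z < len q" "legal c q t (X1 \<inter> {N..})"
    using extends_trans[OF q'(1) q0(1)] q'(2) legal_mono[OF q0(5) q'(1) order_refl] by auto
  obtain m0 where m0: "\<forall>x\<in>X1. m0 \<le> x \<longrightarrow> (2 * z \<in> forced_outputs P X1 (insert x t) \<longleftrightarrow> 2 * z \<in> forced_outputs P X1 t)"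
    using forced_outputs_insert_far[OF set q0(4)] by blast
  have clash: False
    if h: "x \<in> X1" "m0 \<le> x" "Suc (2 * w) \<in> forced_outputs P X1 (insert x t)" "extends r q" "w < len r" "limval r w \<noteq> limval q z"
      "legal c r (insert x t) (X1 \<inter> {M..})" for x w r M
  proof -
    have "limval r z = limval q z" "z < len r" using extends_limval[OF h(4)] extends_len[OF h(4)] q(2) by auto
    then obtain m where "defeats P r (insert x t) (X1 \<inter> {m..})"
      using defeats_lim[of "2 * z" P X1 "insert x t" "Suc (2 * w)" r] m0 h t(2) by auto
    moreover have "insert x t \<subseteq> s \<union> X1" "s \<subseteq> insert x t" "finite (insert x t)" using q0 h(1) by auto
    ultimately show False using tail[OF extends_trans[OF h(4) q(1)] _ _ _ h(7)] by blast
  qed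
  show False
  proof (cases "even (card t)")
    case False
    \<comment> \<open>The next element is a right one, so it stays legal whatever limit is chosen
      for \<open>w\<close>.\<close>
    obtain m1 where m1: "\<forall>x\<in>X1. m1 \<le> x \<longrightarrow> large_odd (len q) (forced_outputs P X1 (insert x t))"
      using t(3) unfolding always_new_def by blast
    obtain x where x: "x \<in> X1" "max N (max bt (max m0 m1)) \<le> x" using inf unfolding infinite_nat_iff_unbounded_le by blast
    then obtain w where w: "len q \<le> w" "Suc (2 * w) \<in> forced_outputs P X1 (insert x t)" using m1 unfolding large_odd_def by auto
    obtain r where r: "extends r q" "Suc w \<le> len r" "\<And>i. len q \<le> i \<Longrightarrow> limval r i = (\<not> limval q z)"
      using extends_exists[of q "Suc w" "\<lambda>_. \<not> limval q z"] by metis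
    have "legal c r (insert x t) (X1 \<inter> {N..})"
      by (rule legal_insert_odd[OF legal_mono[OF q(3) r(1) order_refl] _ _ False]) (use bt x in fastforce)+
    then show False using clash[OF x(1) _ w(2) r(1)] r x w by auto
  next
    case True
    \<comment> \<open>The witness for \<open>e\<close> is the right output that \<open>e\<close>
      releases, and \<open>a\<close> is the limit opposite to that of \<open>z\<close>.\<close>
    have "\<exists>m. \<forall>e\<in>X1 \<inter> {N..}. m \<le> e \<longrightarrow>
        (\<exists>w\<ge>b. \<forall>r M. extends r q \<and> w < len r \<and> limval r w = (\<not> limval q z) \<longrightarrow> \<not> forces_lim r e c M)" for b
    proof -
      obtain m1 where m1: "\<forall>x\<in>X1. m1 \<le> x \<longrightarrow> large_odd b (forced_outputs P X1 (insert x t))"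
        using t(3) unfolding always_new_def by blast
      have "\<exists>w\<ge>b. \<forall>r M. extends r q \<and> w < len r \<and> limval r w = (\<not> limval q z) \<longrightarrow> \<not> forces_lim r e c M"
        if e: "e \<in> X1 \<inter> {N..}" "max bt (max m0 m1) \<le> e" for e
      proof -
        obtain w where w: "b \<le> w" "Suc (2 * w) \<in> forced_outputs P X1 (insert e t)" using m1 e unfolding large_odd_def by auto
        have "\<not> forces_lim r e c M" if r: "extends r q" "w < len r" "limval r w = (\<not> limval q z)" for r M
        proof
          assume "forces_lim r e c M"
          have "legal c r (insert e t) (X1 \<inter> {N..} \<inter> {M..})"
            by (rule legal_insert_even[OF legal_mono[OF q(3) r(1) order_refl] _ \<open>forces_lim r e c M\<close> True])
              (use bt e in fastforce)
          then show False using clash[OF _ _ w(2) r(1,2)] r e unfolding tail_tail by auto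
        qed
        then show ?thesis using w(1) by blast
      qed
      then show ?thesis by blast
    qed
    then have pr: "promise q (X1 \<inter> {N..}) c" unfolding promise_def by blast
    have "promise q (X1 \<inter> {max N bt..}) c" by (rule promise_mono[OF pr extends_refl]) auto
    moreover have "stem_extends s X t (X1 \<inter> {max N bt..})"
      unfolding stem_extends_def stem_def using q0 X1 infinite_tail[OF inf] bt by fastforce
    moreover have "legal c q t (X1 \<inter> {max N bt..})" by (rule legal_mono[OF q(3) extends_refl]) auto
    ultimately show False using no_promise[OF q(1)] by blast
  qed
qed

text \<open>Once the witness of \<open>e\<close> has limit \<open>a\<close>, colour
  \<open>\<not> c\<close> cannot be forced for \<open>e\<close> and \<open>live\<close> leaves only
  \<open>c\<close>. So left elements can be added while only limits are chosen and later values of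
  \<open>f\<close> stay open. Taking \<open>z\<close> at least \<open>len p\<close> keeps the column
  of \<open>z\<close> outside what \<open>p\<close> itself promises.\<close>

lemma defeats_from_promise:
  assumes P: "\<And>k. is_open (P k)" and live: "live p" and prom: "promise p X (\<not> c)"
    and l: "legal c p s X" and st: "stem s X"
  shows "\<exists>q s' X'. extends q p \<and> stem_extends s X s' X' \<and> legal c q s' X' \<and> defeats P q s' X'"
proof (rule ccontr)
  assume no: "\<not> ?thesis"
  have no_defeats: "\<not> defeats P q s' X'"
    if "extends q p" "stem_extends s X s' X'" "legal c q s' X'" for q s' X'
    using no that by blast
  have infX: "infinite X" and fs: "finite s" and sX: "\<And>a x. a \<in> s \<Longrightarrow> x \<in> X \<Longrightarrow> a < x"
    using st by (auto simp: stem_def)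
  obtain X1 where X1: "X1 \<subseteq> X" and set: "settled P X1" using settled_exists[of P, OF P infX] by blast
  have inf: "infinite X1" using set by (simp add: settled_def)
  have tail: "\<not> defeats P q t (X1 \<inter> {m..})"
    if "extends q p" "s \<subseteq> t" "t \<subseteq> s \<union> X1" "finite t" "legal c q t (X1 \<inter> {N..})" for q t N m
    by (rule not_defeats_tail[OF no_defeats[OF that(1)] X1 inf that(2-5)])
  from prom obtain a where a: "\<forall>b. \<exists>m. \<forall>e\<in>X. m \<le> e \<longrightarrow>
     (\<exists>w\<ge>b. \<forall>q N. extends q p \<and> w < len q \<and> limval q w = a \<longrightarrow> \<not> forces_lim q e (\<not> c) N)"
    unfolding promise_def ..
  define Pr where "Pr w e \<longleftrightarrow> (\<forall>q N. extends q p \<and> w < len q \<and> limval q w = a \<longrightarrow> \<not> forces_lim q e (\<not> c) N)" for w e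
  have Pr: "\<exists>m. \<forall>e\<in>X1. m \<le> e \<longrightarrow> (\<exists>w\<ge>b. Pr w e)" for b
  proof -
    from a[folded Pr_def, THEN spec, of b] obtain m where m: "\<forall>e\<in>X. m \<le> e \<longrightarrow> (\<exists>w\<ge>b. Pr w e)" ..
    show ?thesis using m[THEN bspec, OF subsetD[OF X1]] by (intro exI[of _ m] ballI) simp
  qed
  \<comment> \<open>Tentative stems. Colours are controlled over colourings in \<open>cyl p\<close>
    that merely agree with \<open>q\<close>, and the \<open>f'\<close>-limits of new left elements
    are secured through \<open>limval\<close> alone; both survive a weak extension of
    \<open>q\<close> that still extends \<open>p\<close>. Left elements from \<open>s\<close> are
    covered by \<open>l\<close>.\<close>
  define S where "S q t \<longleftrightarrow> extends q p \<and> s \<subseteq> t \<and> t \<subseteq> s \<union> X1 \<and> finite t \<and>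
      (\<forall>e\<in>ev t - s. \<exists>w<len q. limval q w = a \<and> Pr w e) \<and>
      (\<forall>e\<in>ev t. \<forall>y\<in>od t. e < y \<longrightarrow> (\<forall>f\<in>cyl p. agrees q f \<longrightarrow> \<not> F f e y (\<not> c)))" for q t
  have S_mono: "S r t" if "S q t" "extends r p" "weak_extends r q" for q r t
  proof -
    have "\<exists>w<len r. limval r w = a \<and> Pr w e" if "\<exists>w<len q. limval q w = a \<and> Pr w e" for e
      using that \<open>weak_extends r q\<close> unfolding weak_extends_def by (meson less_le_trans)
    then have "\<forall>e\<in>ev t - s. \<exists>w<len r. limval r w = a \<and> Pr w e" using that(1) unfolding S_def by simp
    moreover have "\<forall>e\<in>ev t. \<forall>y\<in>od t. e < y \<longrightarrow> (\<forall>f\<in>cyl p. agrees r f \<longrightarrow> \<not> F f e y (\<not> c))"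
      using that(1) agrees_weak_extends[OF _ that(3)] unfolding S_def by simp
    ultimately show ?thesis using that(1,2) unfolding S_def by simp
  qed
  \<comment> \<open>\<open>live\<close> yields some forced limit for each \<open>e\<close>, and
    \<open>Pr\<close> excludes \<open>\<not> c\<close>.\<close>
  have force: "\<exists>r' N. extends r' r \<and> (\<forall>e\<in>E. forces_lim r' e c N)"
    if "finite E" "extends r p" "\<forall>e\<in>E. \<exists>w<len r. limval r w = a \<and> Pr w e" for r E
    using that
  proof (induction E rule: finite_induct)
    case empty
    then show ?case using extends_refl by blast
  next
    case (insert e E)
    then obtain r1 N1 where r1: "extends r1 r" "\<forall>e\<in>E. forces_lim r1 e c N1" by auto
    obtain w where w: "w < len r" "limval r w = a" "Pr w e" using insert.prems by auto
    have "extends r1 p" using extends_trans[OF r1(1) insert.prems(1)] .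
    then obtain r2 d N2 where r2: "extends r2 r1" "forces_lim r2 e d N2" using live unfolding live_def by blast
    have "extends r2 r" using extends_trans[OF r2(1) r1(1)] .
    then have "extends r2 p" "w < len r2" "limval r2 w = a"
      using extends_trans[OF _ insert.prems(1)] w extends_len[of r2 r] extends_limval[of r2 r w] by auto
    then have "\<not> forces_lim r2 e (\<not> c) N2" using w(3) unfolding Pr_def by blast
    then have "d = c" using r2(2) by (cases "d = c") auto
    then have "\<forall>e\<in>insert e E. forces_lim r2 e c (max N1 N2)"
      using r1(2) r2 forces_lim_mono[OF _ r2(1)] forces_lim_mono[OF _ extends_refl[of r2]] by auto
    then show ?case using \<open>extends r2 r\<close> by blast
  qed
  \<comment> \<open>At any moment a tentative stem can be made legal by a true extension, so it is
    subject to \<open>tail\<close>.\<close>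
  have commit: "\<exists>r N. extends r q \<and> legal c r t (X1 \<inter> {N..})" if S: "S q t" for q t
  proof -
    have q: "extends q p" "s \<subseteq> t" "t \<subseteq> s \<union> X1" "finite t" using S unfolding S_def by auto
    have "finite (ev t - s)" using finite_subset[OF ev_subset(1) q(4)] by simp
    moreover have "\<forall>e\<in>ev t - s. \<exists>w<len q. limval q w = a \<and> Pr w e" using S unfolding S_def by blast
    ultimately obtain r N where r: "extends r q" "\<forall>e\<in>ev t - s. forces_lim r e c N" using force[OF _ q(1)] by blast
    have evs: "e \<in> ev s" if "e \<in> ev t" "e \<in> s" for e
    proof -
      have "t = s \<union> (t - s)" using q(2) by blast
      moreover have "i < y" if "i \<in> s" "y \<in> t - s" for i y using that q(3) X1 sX by blast
      ultimately show ?thesis using ev_initial(1)[of s "t - s"] that by auto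
    qed
    have "\<not> F f e y (\<not> c)" if e: "e \<in> ev t" and y: "y \<in> od t \<union> X1 \<inter> {N..}" and ey: "e < y" and f: "f \<in> cyl r" for e y f
    proof (cases "y \<in> od t")
      case True
      have "f \<in> cyl p" "agrees q f" using f cyl_extends[OF extends_trans[OF r(1) q(1)]] cyl_extends[OF r(1)] cyl_agrees by blast+
      then show ?thesis using S e True ey unfolding S_def by blast
    next
      case False
      then have y: "y \<in> X1" "N \<le> y" using y by auto
      show ?thesis
      proof (cases "e \<in> s")
        case True
        have "f \<in> cyl p" using f cyl_extends[OF extends_trans[OF r(1) q(1)]] by blast
        then show ?thesis using l evs[OF e True] y(1) X1 ey unfolding legal_def by blast
      next
        case False
        then have "forces_lim r e c N" using r(2) e by blast
        then show ?thesis using f y unfolding forces_lim_def by blast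
      qed
    qed
    then have "legal c r t (X1 \<inter> {N..})" unfolding legal_def by blast
    then show ?thesis using r(1) by blast
  qed
  define T where "T = {t. \<exists>q. S q t}"
  have "S p s" unfolding S_def
    using fs extends_refl[of p] l ev_subset(1)[of s] unfolding legal_def by auto
  then have s: "s \<in> T" unfolding T_def by blast
  have fin: "finite t" if "t \<in> T" for t using that by (auto simp: T_def S_def)
  have S_insert_even: "S r (insert e t)"
    if S: "S r t" and ev: "even (card t)" and e: "e \<in> X1" "\<And>i. i \<in> t \<Longrightarrow> i < e" and w: "w < len r" "limval r w = a" "Pr w e"
    for r t e w
  proof -
    have i: "ev (insert e t) = insert e (ev t)" "od (insert e t) = od t" using ev_insert[of t e] e(2) ev by auto
    have "\<not> e < y" if "y \<in> od t" for y using e(2)[of y] ev_subset(2) that by fastforce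
    then show ?thesis using S e(1) w unfolding S_def i by auto
  qed
  have step: "\<exists>x\<in>X1. m \<le> x \<and> insert x t \<in> T" if tT: "t \<in> T" for t m
  proof -
    obtain q where S: "S q t" using tT unfolding T_def by blast
    then have q: "extends q p" "s \<subseteq> t" "t \<subseteq> s \<union> X1" "finite t" unfolding S_def by auto
    show ?thesis
    proof (cases "even (card t)")
      case True
      obtain m1 where m1: "\<forall>e\<in>X1. m1 \<le> e \<longrightarrow> (\<exists>w\<ge>len q. Pr w e)" using Pr by blast
      obtain e where e: "e \<in> X1" "max m m1 \<le> e" "\<And>i. i \<in> t \<Longrightarrow> i < e" using pick_above[OF inf q(4)] by metis
      then obtain w where w: "len q \<le> w" "Pr w e" using m1 by auto
      obtain r where r: "extends r q" "Suc w \<le> len r" "\<And>i. len q \<le> i \<Longrightarrow> limval r i = a"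
        using extends_exists[of q "Suc w" "\<lambda>_. a"] by metis
      have "S r (insert e t)"
        by (rule S_insert_even[OF S_mono[OF S extends_trans[OF r(1) q(1)] extends_weak[OF r(1)]] True e(1,3)])
          (use r w in auto)
      then have "insert e t \<in> T" unfolding T_def by blast
      then show ?thesis using e by auto
    next
      case False
      \<comment> \<open>\<open>commit\<close> serves to learn the colour at \<open>g\<close>:
        legality excludes \<open>\<not> c\<close>, and \<open>live\<close> decides the value, which
        is therefore \<open>c\<close>. The decision depends on finitely many pairs, so it remains
        valid under later weak extensions.\<close>
      obtain r N where r: "extends r q" "legal c r t (X1 \<inter> {N..})" using commit[OF S] by blast
      obtain g where g: "g \<in> X1" "max m N \<le> g" "\<And>i. i \<in> t \<Longrightarrow> i < g" using pick_above[OF inf q(4)] by metis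
      have "\<exists>r'. extends r' r \<and> (\<forall>e\<in>E. \<exists>b. decides r' e g b)" if "finite E" for E
        using that
      proof (induction E rule: finite_induct)
        case empty
        then show ?case using extends_refl by blast
      next
        case (insert e E)
        then obtain r1 where r1: "extends r1 r" "\<forall>e\<in>E. \<exists>b. decides r1 e g b" by blast
        have "extends r1 p" using extends_trans[OF r1(1) extends_trans[OF r(1) q(1)]] .
        then obtain r2 b where r2: "extends r2 r1" "decides r2 e g b" using live unfolding live_def by blast
        then show ?case using r1 decides_mono[OF _ extends_weak[OF r2(1)]] extends_trans[OF r2(1) r1(1)] by (intro exI[of _ r2]) blast
      qed
      then obtain r' where r': "extends r' r" "\<forall>e\<in>ev t. \<exists>b. decides r' e g b"
        using finite_subset[OF ev_subset(1) q(4)] by blast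
      have dec: "decides r' e g c" if e: "e \<in> ev t" for e
      proof -
        obtain b where b: "decides r' e g b" using r'(2) e by blast
        obtain f where f: "f \<in> cyl r'" using cyl_nonempty by blast
        have "F f e g b" using b cyl_agrees[OF f] unfolding decides_def by blast
        moreover have "\<not> F f e g (\<not> c)"
        proof -
          have "e < g" "f \<in> cyl r" "g \<in> od t \<union> X1 \<inter> {N..}"
            using e g ev_subset(1)[of t] f cyl_extends[OF r'(1)] by auto
          then show ?thesis using r(2) e unfolding legal_def by blast
        qed
        ultimately have "b = c" by (cases "b = c") auto
        then show ?thesis using b by simp
      qed
      have i: "ev (insert g t) = ev t" "od (insert g t) = insert g (od t)" using ev_insert[of t g] g(3) False by auto
      have r'q: "extends r' q" using extends_trans[OF r'(1) r(1)] .
      have S': "S r' t" using S_mono[OF S extends_trans[OF r'q q(1)] extends_weak[OF r'q]] .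
      have "\<not> F f e g (\<not> c)" if "e \<in> ev t" "agrees r' f" for e f
        using dec[OF that(1)] that(2) F_det[of f e g c "\<not> c"] unfolding decides_def by blast
      then have "S r' (insert g t)" using S' g(1) unfolding S_def i by auto
      then have "insert g t \<in> T" unfolding T_def by blast
      then show ?thesis using g by auto
    qed
  qed
  have QLR: "far X1 (\<lambda>Y. out_left P b (t \<union> Y))" "far X1 (\<lambda>Y. out_right P b (t \<union> Y))" if "t \<in> T" for t b
  proof -
    obtain q where S: "S q t" using \<open>t \<in> T\<close> unfolding T_def by blast
    then have q: "extends q p" "s \<subseteq> t" "t \<subseteq> s \<union> X1" "finite t" unfolding S_def by auto
    obtain r N where r: "extends r q" "legal c r t (X1 \<inter> {N..})" using commit[OF S] by blast
    show "far X1 (\<lambda>Y. out_left P b (t \<union> Y))" "far X1 (\<lambda>Y. out_right P b (t \<union> Y))"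
      using not_defeats_far[OF set q(4) tail[OF extends_trans[OF r(1) q(1)] q(2-4) r(2)]] by blast+
  qed
  obtain t z where t: "t \<in> T" "len p \<le> z" "2 * z \<in> forced_outputs P X1 t" "always_new P X1 t"
    using always_new_stem_exists[of P, OF P set s fin step QLR, of "len p"] by metis
  obtain q0 where S0: "S q0 t" using t(1) unfolding T_def by blast
  obtain q where q': "extends q q0" "Suc z \<le> len q" using extends_exists[of q0 "Suc z"] by metis
  have "extends q0 p" using S0 unfolding S_def by simp
  from S_mono[OF S0 extends_trans[OF q'(1) this] extends_weak[OF q'(1)]] have S: "S q t" .
  then have q: "extends q p" "s \<subseteq> t" "t \<subseteq> s \<union> X1" "finite t" unfolding S_def by auto
  obtain m0 where m0: "\<forall>x\<in>X1. m0 \<le> x \<longrightarrow> (2 * z \<in> forced_outputs P X1 (insert x t) \<longleftrightarrow> 2 * z \<in> forced_outputs P X1 t)"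
    using forced_outputs_insert_far[OF set q(4)] by blast
  show False
  proof (cases "even (card t)")
    case False
    obtain r N where r: "extends r q" "legal c r t (X1 \<inter> {N..})" using commit[OF S] by blast
    obtain m1 where m1: "\<forall>x\<in>X1. m1 \<le> x \<longrightarrow> large_odd (len r) (forced_outputs P X1 (insert x t))"
      using t(4) unfolding always_new_def by blast
    obtain x where x: "x \<in> X1" "max N (max m0 m1) \<le> x" "\<And>i. i \<in> t \<Longrightarrow> i < x" using pick_above[OF inf q(4)] by metis
    then obtain w where w: "len r \<le> w" "Suc (2 * w) \<in> forced_outputs P X1 (insert x t)" using m1 unfolding large_odd_def by auto
    obtain r' where r': "extends r' r" "Suc w \<le> len r'" "\<And>i. len r \<le> i \<Longrightarrow> limval r' i = (\<not> limval r z)"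
      using extends_exists[of r "Suc w" "\<lambda>_. \<not> limval r z"] by metis
    have "legal c r' (insert x t) (X1 \<inter> {N..})"
      by (rule legal_insert_odd[OF legal_mono[OF r(2) r'(1) order_refl] _ _ False]) (use x in fastforce)+
    moreover have "limval r' z = limval r z" "z < len r'"
      using extends_limval[OF r'(1)] extends_len[OF r'(1)] extends_len[OF r(1)] q'(2) by auto
    then obtain m where "defeats P r' (insert x t) (X1 \<inter> {m..})"
      using defeats_lim[of "2 * z" P X1 "insert x t" "Suc (2 * w)" r'] m0 t(3) x r' w by auto
    moreover have "insert x t \<subseteq> s \<union> X1" "s \<subseteq> insert x t" "finite (insert x t)" using q x(1) by auto
    ultimately show False using tail[OF extends_trans[OF r'(1) extends_trans[OF r(1) q(1)]]] by blast
  next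
    case True
    obtain m1 where m1: "\<forall>x\<in>X1. m1 \<le> x \<longrightarrow> large_odd (len q) (forced_outputs P X1 (insert x t))"
      using t(4) unfolding always_new_def by blast
    obtain m2 where m2: "\<forall>e\<in>X1. m2 \<le> e \<longrightarrow> (\<exists>w\<ge>len q. Pr w e)" using Pr by blast
    obtain e where e: "e \<in> X1" "max m0 (max m1 m2) \<le> e" "\<And>i. i \<in> t \<Longrightarrow> i < e" using pick_above[OF inf q(4)] by metis
    then obtain w where w: "len q \<le> w" "Suc (2 * w) \<in> forced_outputs P X1 (insert e t)" using m1 unfolding large_odd_def by auto
    obtain v where v: "len q \<le> v" "Pr v e" using m2 e by auto
    \<comment> \<open>\<open>w\<close> may coincide with \<open>v\<close>, whose limit has to be
      \<open>a\<close>, so unequal limits are not always available. Instead \<open>r\<close> keeps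
      the promises of \<open>p\<close> but gives the columns from \<open>len p\<close> up to
      \<open>len q\<close> values opposite to their limits on all new pairs, among them
      \<open>(z, w)\<close>.\<close>
    define r :: cond where "r = (Suc (max v w),
      \<lambda>x y. if y < len q then col q x y else if x < len p then limval p x else if x < len q then \<not> limval q x else False,
      \<lambda>x. if x < len q then limval q x else a)"
    have rq: "weak_extends r q" using w v unfolding weak_extends_def r_def by auto
    have rp: "extends r p" unfolding extends_def
    proof (intro conjI allI impI)
      show "weak_extends r p" using weak_extends_trans[OF rq extends_weak[OF q(1)]] .
      fix x y assume "x < len p \<and> len p \<le> y \<and> y < len r"
      then show "col r x y = limval p x" using q(1) unfolding r_def extends_def by auto
    qed
    have "S r (insert e t)"
      by (rule S_insert_even[OF S_mono[OF S rp rq] True e(1,3), where w = v]) (use v in \<open>auto simp: r_def\<close>)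
    then obtain r' N where r': "extends r' r" "legal c r' (insert e t) (X1 \<inter> {N..})" using commit by blast
    have z: "z < len q" "len p \<le> z" using q'(2) t(2) by auto
    have zr: "z < w" "w < len r" "col r z w \<noteq> limval r z" using z w unfolding r_def by auto
    then have "w < len r'" "col r' z w \<noteq> limval r' z"
      using r'(1) extends_len[OF r'(1)] unfolding extends_def weak_extends_def by auto
    then obtain m where "defeats P r' (insert e t) (X1 \<inter> {m..})"
      using defeats_pair[of z P X1 "insert e t" w r'] zr(1) w(2) m0 t(3) e by auto
    moreover have "insert e t \<subseteq> s \<union> X1" "s \<subseteq> insert e t" "finite (insert e t)" using q e(1) by auto
    ultimately show False using tail[OF extends_trans[OF r'(1) rp] _ _ _ r'(2)] by blast
  qed
qed

end

section \<open>Both sides together: a stem for each colour over one common reservoir\<close>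

type_synonym data = "(bool \<Rightarrow> nat set) \<times> nat set"

definition data_extends :: "data \<Rightarrow> data \<Rightarrow> bool" where
  "data_extends d d' \<longleftrightarrow> (\<forall>c. stem_extends (fst d c) (snd d) (fst d' c) (snd d'))"

lemma data_extends_trans: "data_extends d d' \<Longrightarrow> data_extends d' d'' \<Longrightarrow> data_extends d d''"
  unfolding data_extends_def using stem_extends_trans by blast

context partial_coloring
begin

definition never_stable :: "cond \<Rightarrow> bool" where
  "never_stable p \<longleftrightarrow> (\<exists>x s. \<forall>q b. extends q p \<longrightarrow> \<not> decides q x s b) \<or> (\<exists>x. \<forall>q c N. extends q p \<longrightarrow> \<not> forces_lim q x c N)"

definition side_blocked :: "bool \<Rightarrow> cond \<Rightarrow> nat set \<Rightarrow> bool" where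
  "side_blocked c p X \<longleftrightarrow> (\<forall>e\<in>X. \<forall>q N. extends q p \<longrightarrow> \<not> forces_lim q e c N)"

text \<open>Failure need not block \<open>c\<close> at \<open>p\<close>; it gives blocking below
  some extension and on some tail.\<close>

definition side_available :: "bool \<Rightarrow> cond \<Rightarrow> nat set \<Rightarrow> bool" where
  "side_available c p X \<longleftrightarrow> (\<forall>q m. extends q p \<longrightarrow> (\<exists>e\<in>X. m \<le> e \<and> (\<exists>r N. extends r q \<and> forces_lim r e c N)))"

definition valid :: "cond \<Rightarrow> data \<Rightarrow> bool" where
  "valid p d \<longleftrightarrow> (\<forall>c. legal c p (fst d c) (snd d) \<and> stem (fst d c) (snd d))"

lemma side_blocked_mono: "side_blocked c p X \<Longrightarrow> extends q p \<Longrightarrow> X' \<subseteq> X \<Longrightarrow> side_blocked c q X'"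
  unfolding side_blocked_def using extends_trans by blast

lemma side_available_mono:
  assumes "side_available c p X" "extends q p" shows "side_available c q (X \<inter> {m..})"
  unfolding side_available_def
proof (intro allI impI)
  fix r k assume r: "extends r q"
  obtain e r' N where e: "e \<in> X" "max k m \<le> e" "extends r' r" "forces_lim r' e c N"
    using assms(1) extends_trans[OF r assms(2)] unfolding side_available_def by blast
  then have "e \<in> X \<inter> {m..}" "k \<le> e" by auto
  then show "\<exists>e\<in>X \<inter> {m..}. k \<le> e \<and> (\<exists>r' N. extends r' r \<and> forces_lim r' e c N)" using e(3,4) by blast
qed

lemma side_blocked_promise:
  assumes "side_blocked c p X" shows "promise p X c"
  unfolding promise_def
proof (rule exI[of _ True], rule allI, rule exI[of _ 0], intro ballI impI)
  fix b e assume "e \<in> X"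
  then show "\<exists>w\<ge>b. \<forall>q N. extends q p \<and> w < len q \<and> limval q w = True \<longrightarrow> \<not> forces_lim q e c N"
    using assms unfolding side_blocked_def by blast
qed

lemma side_blocked_side_available:
  assumes "live p" "side_blocked (\<not> c) p X" "infinite X" shows "side_available c p X"
  unfolding side_available_def
proof (intro allI impI)
  fix q m assume q: "extends q p"
  obtain e where e: "e \<in> X" "m \<le> e" using assms(3) unfolding infinite_nat_iff_unbounded_le by blast
  obtain r d N where r: "extends r q" "forces_lim r e d N" using assms(1) q unfolding live_def by blast
  have "\<not> forces_lim r e (\<not> c) N" using assms(2) e(1) extends_trans[OF r(1) q] unfolding side_blocked_def by blast
  then have "d = c" using r(2) by (cases "d = c") auto
  then show "\<exists>e\<in>X. m \<le> e \<and> (\<exists>r N. extends r q \<and> forces_lim r e c N)" using e r by blast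
qed

lemma not_side_available_side_blocked:
  assumes "\<not> side_available c p X"
  obtains q m where "extends q p" "side_blocked c q (X \<inter> {m..})"
proof -
  obtain q m where q: "extends q p" "\<not> (\<exists>e\<in>X. m \<le> e \<and> (\<exists>r N. extends r q \<and> forces_lim r e c N))"
    using assms unfolding side_available_def by blast
  then have "side_blocked c q (X \<inter> {m..})" unfolding side_blocked_def by blast
  with q(1) show ?thesis by (rule that)
qed

lemma not_live_never_stable:
  assumes "\<not> live p" obtains q where "extends q p" "never_stable q"
proof -
  obtain q where "extends q p" "(\<exists>x s. \<forall>r b. extends r q \<longrightarrow> \<not> decides r x s b) \<or> (\<exists>x. \<forall>r c N. extends r q \<longrightarrow> \<not> forces_lim r x c N)"
    using assms unfolding live_def by blast
  then show ?thesis by (intro that[of q]) (simp_all only: never_stable_def)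
qed

text \<open>The source of genericity for limits: if the actual \<open>f'\<close> has limit
  \<open>c\<close> at \<open>x\<close>, the first alternative must fail for late \<open>N\<close>,
  so the limit gets forced.\<close>

lemma decide_or_force: "\<exists>q. extends q p \<and> ((\<exists>s\<ge>N. decides q x s (\<not> c)) \<or> forces_lim q x c N)"
proof (cases "forces_lim p x c N")
  case True
  then show ?thesis using extends_refl by blast
next
  case False
  then obtain f s where "f \<in> cyl p" "N \<le> s" "F f x s (\<not> c)" unfolding forces_lim_def by blast
  then show ?thesis using decide by metis
qed

lemma valid_mono:
  assumes "valid p (s, X)" "extends q p" shows "valid q (s, X)"
  using assms legal_mono unfolding valid_def by fastforce

text \<open>The other side only loses a part of its reservoir, which harms neither its legality nor
  its stem.\<close>

lemma valid_update:
  assumes i: "valid p (s, X)" and q: "extends q p" and st: "stem_extends (s c) X t X'" and l: "legal c q t X'"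
  shows "valid q (s(c := t), X') \<and> data_extends (s, X) (s(c := t), X')"
proof -
  have X': "X' \<subseteq> X" "stem t X'" using st unfolding stem_extends_def by auto
  have "legal d q (s d) X'" for d using i legal_mono[OF _ q X'(1)] unfolding valid_def by simp
  moreover have stem: "stem (s d) X'" for d
  proof -
    have "stem (s d) X" using i unfolding valid_def by simp
    then show ?thesis using X' unfolding stem_def by blast
  qed
  ultimately have "valid q (s(c := t), X')" using l X'(2) unfolding valid_def by simp
  moreover have "stem_extends (s d) X (s d) X'" for d using stem[of d] X'(1) unfolding stem_extends_def by blast
  ultimately show ?thesis using st unfolding data_extends_def by simp
qed

lemma grow:
  assumes i: "valid p (s, X)" and av: "side_available c p X"
  obtains q t m where "extends q p" "valid q (s(c := t), X \<inter> {m..})" "data_extends (s, X) (s(c := t), X \<inter> {m..})"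
    "card (s c) < card t"
proof -
  have l: "legal c p (s c) X" and st: "stem (s c) X" using i unfolding valid_def by auto
  have inf: "infinite X" and fin: "finite (s c)" using st unfolding stem_def by auto
  have less: "a < x" if "a \<in> s c" "x \<in> X" for a x using st that unfolding stem_def by blast
  have "\<exists>q x N. extends q p \<and> x \<in> X \<and> legal c q (insert x (s c)) (X \<inter> {N..})"
  proof (cases "even (card (s c))")
    case True
    obtain e q N where e: "e \<in> X" "extends q p" "forces_lim q e c N" using av extends_refl unfolding side_available_def by blast
    have "legal c q (insert e (s c)) (X \<inter> {N..})"
      by (rule legal_insert_even[OF legal_mono[OF l e(2) order_refl] _ e(3) True]) (use less e(1) in blast)
    then show ?thesis using e by blast
  next
    case False
    obtain x where x: "x \<in> X" using inf by (metis ex_in_conv finite.emptyI)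
    have "legal c p (insert x (s c)) X" by (rule legal_insert_odd[OF l _ x False]) (use less x in blast)
    then have "legal c p (insert x (s c)) (X \<inter> {0..})" by simp
    then show ?thesis using x extends_refl by blast
  qed
  then obtain q x N where q: "extends q p" "x \<in> X" "legal c q (insert x (s c)) (X \<inter> {N..})" by blast
  have "legal c q (insert x (s c)) (X \<inter> {max N (Suc x)..})" by (rule legal_mono[OF q(3) extends_refl]) auto
  moreover have "stem_extends (s c) X (insert x (s c)) (X \<inter> {max N (Suc x)..})"
    unfolding stem_extends_def stem_def using fin infinite_tail[OF inf] q(2) less by auto
  moreover have "card (s c) < card (insert x (s c))" using fin less q(2) by (metis card_insert_disjoint lessI less_irrefl)
  ultimately show ?thesis using that[OF q(1)] valid_update[OF i q(1)] by blast
qed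

lemma data_extends_card:
  assumes "data_extends d d'" shows "card (fst d c) \<le> card (fst d' c)"
proof (rule card_mono)
  show "finite (fst d' c)" "fst d c \<subseteq> fst d' c"
    using assms unfolding data_extends_def stem_extends_def stem_def by auto
qed

lemma data_extends_side_blocked: "side_blocked c p (snd d) \<Longrightarrow> extends q p \<Longrightarrow> data_extends d d' \<Longrightarrow> side_blocked c q (snd d')"
  using side_blocked_mono unfolding data_extends_def stem_extends_def by blast

text \<open>A side whose opposite is blocked must be served alone; otherwise one of the two functionals
  \<open>P False\<close>, \<open>P True\<close> is defeated on its own side.\<close>

definition progress :: "(bool \<Rightarrow> nat \<Rightarrow> nat set \<Rightarrow> bool) \<Rightarrow> cond \<Rightarrow> data \<Rightarrow> cond \<Rightarrow> data \<Rightarrow> bool" where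
  "progress P p d q d' \<longleftrightarrow> never_stable q \<or>
     ((\<forall>c. side_blocked (\<not> c) p (snd d) \<longrightarrow> defeats (P c) q (fst d' c) (snd d') \<and> card (fst d c) < card (fst d' c)) \<and>
      ((\<exists>c. side_blocked c q (snd d')) \<or>
       (\<forall>c. card (fst d c) < card (fst d' c)) \<and> (\<exists>c. defeats (P c) q (fst d' c) (snd d'))))"

lemma progress_exists:
  assumes P: "\<And>c k. is_open (P c k)" and i: "valid p d"
  shows "\<exists>q d'. extends q p \<and> valid q d' \<and> data_extends d d' \<and> progress P p d q d'"
proof -
  obtain s X where d: "d = (s, X)" by (cases d)
  have i: "valid p (s, X)" using i unfolding d .
  have inf: "infinite X" using i unfolding valid_def stem_def by simp
  have refl: "data_extends (s, X) (s, X)" using i stem_extends_refl unfolding valid_def data_extends_def by simp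
  have sfp: "\<exists>q d'. extends q p \<and> valid q d' \<and> data_extends e d' \<and> defeats (P c) q (fst d' c) (snd d')"
    if h: "live p" "valid p e" "promise p (snd e) (\<not> c)" for c p and e :: data
  proof -
    obtain s X where e: "e = (s, X)" by (cases e)
    have l: "legal c p (s c) X" "stem (s c) X" using h(2) unfolding valid_def e by auto
    obtain q t X' where "extends q p" "stem_extends (s c) X t X'" "legal c q t X'" "defeats (P c) q t X'"
      using defeats_from_promise[of "P c", OF P h(1) _ l] h(3) unfolding e by auto
    then show ?thesis using valid_update[of p s X q c t X'] h(2) unfolding e
      by (intro exI[of _ q] exI[of _ "(s(c := t), X')"]) auto
  qed
  have "side_blocked c p X \<Longrightarrow> \<exists>c. side_blocked (\<not> c) p X" for c by (intro exI[of _ "\<not> c"]) simp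
  then consider (dead) "\<not> live p" | (one) c where "live p" "side_blocked (\<not> c) p X"
    | (none) c where "\<not> side_available c p X" "\<forall>c. \<not> side_blocked c p X"
    | (both) "live p" "\<forall>c. side_available c p X" "\<forall>c. \<not> side_blocked c p X" by blast
  then show ?thesis
  proof cases
    case dead
    then obtain q where "extends q p" "never_stable q" by (rule not_live_never_stable)
    then show ?thesis using valid_mono[OF i] refl unfolding d progress_def by blast
  next
    case one
    have av: "side_available c p X" using side_blocked_side_available[OF one inf] .
    obtain q t m where q: "extends q p" "valid q (s(c := t), X \<inter> {m..})" "data_extends (s, X) (s(c := t), X \<inter> {m..})"
      "card (s c) < card t" using grow[OF i av] by metis
    have "side_blocked (\<not> c) q (X \<inter> {m..})" using side_blocked_mono[OF one(2) q(1)] by simp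
    then obtain r d' where r: "extends r q" "valid r d'" "data_extends (s(c := t), X \<inter> {m..}) d'" "defeats (P c) r (fst d' c) (snd d')"
      using sfp[OF live_mono[OF one(1) q(1)] q(2), of c] side_blocked_promise by auto
    have rp: "extends r p" and dd: "data_extends (s, X) d'" using extends_trans[OF r(1) q(1)] data_extends_trans[OF q(3) r(3)] by auto
    have c: "card (s c) < card (fst d' c)" using data_extends_card[OF r(3), of c] q(4) by simp
    have "\<not> side_blocked c p X"
    proof
      assume ns: "side_blocked c p X"
      obtain e where "e \<in> X" using inf by (metis ex_in_conv finite.emptyI)
      moreover obtain r N where "extends r p" "forces_lim r e c N" if "e \<in> X" for e
        using av extends_refl unfolding side_available_def using ns side_blocked_def by blast
      ultimately show False using ns unfolding side_blocked_def by blast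
    qed
    then have "side_blocked (\<not> c') p X \<longrightarrow> c' = c" for c' by (cases "c' = c") auto
    moreover have "side_blocked (\<not> c) r (snd d')" using data_extends_side_blocked[of "\<not> c" p "(s, X)" r d'] one(2) rp dd by simp
    ultimately show ?thesis using rp r(2,4) dd c unfolding d progress_def by (intro exI[of _ r] exI[of _ d']) auto
  next
    case none
    obtain q m where q: "extends q p" "side_blocked c q (X \<inter> {m..})" using not_side_available_side_blocked[OF none(1)] by metis
    have "valid q (s, X \<inter> {m..}) \<and> data_extends (s, X) (s, X \<inter> {m..})"
    proof -
      have "stem_extends (s c) X (s c) (X \<inter> {m..})" "legal c q (s c) (X \<inter> {m..})"
        using i infinite_tail[OF inf] legal_mono[OF _ q(1), of c "s c" X "X \<inter> {m..}"]
        unfolding valid_def stem_extends_def stem_def by auto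
      from valid_update[OF i q(1) this] show ?thesis by simp
    qed
    then show ?thesis using q none(2) unfolding d progress_def
      by (intro exI[of _ q] exI[of _ "(s, X \<inter> {m..})"]) auto
  next
    case both
    obtain q0 t0 m0 where q0: "extends q0 p" "valid q0 (s(True := t0), X \<inter> {m0..})"
      "data_extends (s, X) (s(True := t0), X \<inter> {m0..})" "card (s True) < card t0" using grow[OF i both(2)[THEN spec]] by metis
    define s0 where "s0 = s(True := t0)"
    obtain q1 t1 m1 where q1: "extends q1 q0" "valid q1 (s0(False := t1), X \<inter> {m0..} \<inter> {m1..})"
      "data_extends (s0, X \<inter> {m0..}) (s0(False := t1), X \<inter> {m0..} \<inter> {m1..})" "card (s0 False) < card t1"
      using grow[OF q0(2) side_available_mono[OF both(2)[THEN spec] q0(1)], folded s0_def] by metis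
    define s1 where "s1 = s0(False := t1)"
    define X1 where "X1 = X \<inter> {m0..} \<inter> {m1..}"
    have q1p: "extends q1 p" and d1: "data_extends (s, X) (s1, X1)" and i1: "valid q1 (s1, X1)"
      using extends_trans[OF q1(1) q0(1)] data_extends_trans[OF q0(3)] q1(2,3) unfolding s0_def s1_def X1_def by auto
    have c1: "card (s c) < card (s1 c)" for c
      using q0(4) q1(4) unfolding s1_def s0_def by (cases c) auto
    have "legal True q1 (s1 True) X1" "stem (s1 True) X1" using i1 unfolding valid_def by auto
    from defeats_or_promise[of "P True", OF P this] obtain q2 t2 X2 where
      q2: "extends q2 q1" "stem_extends (s1 True) X1 t2 X2" "legal True q2 t2 X2" "defeats (P True) q2 t2 X2 \<or> promise q2 X2 True" by blast
    have i2: "valid q2 (s1(True := t2), X2)" and d2: "data_extends (s1, X1) (s1(True := t2), X2)"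
      using valid_update[OF i1 q2(1-3)] by auto
    have "\<exists>q d'. extends q q2 \<and> valid q d' \<and> data_extends (s1(True := t2), X2) d' \<and> (\<exists>c. defeats (P c) q (fst d' c) (snd d'))"
    proof (cases "defeats (P True) q2 t2 X2")
      case True
      have "data_extends (s1(True := t2), X2) (s1(True := t2), X2)" using i2 stem_extends_refl unfolding valid_def data_extends_def by simp
      then show ?thesis using True i2 extends_refl by (intro exI[of _ q2] exI[of _ "(s1(True := t2), X2)"]) auto
    next
      case False
      then have "promise q2 (snd (s1(True := t2), X2)) (\<not> False)" using q2(4) by simp
      from sfp[OF live_mono[OF both(1) extends_trans[OF q2(1) q1p]] i2 this] show ?thesis by blast
    qed
    then obtain q d' where q: "extends q q2" "valid q d'" "data_extends (s1(True := t2), X2) d'" "\<exists>c. defeats (P c) q (fst d' c) (snd d')"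
      by blast
    have qp: "extends q p" using extends_trans[OF q(1) extends_trans[OF q2(1) q1p]] .
    have d1': "data_extends (s1, X1) d'" and d': "data_extends (s, X) d'"
      using data_extends_trans[OF d2 q(3)] data_extends_trans[OF d1] by auto
    have "card (s c) < card (fst d' c)" for c using c1[of c] data_extends_card[OF d1', of c] by simp
    then show ?thesis using qp q(2,4) d' both(3) unfolding d progress_def by (intro exI[of _ q] exI[of _ d']) auto
  qed
qed

lemma progress_weaken: "progress P p d q d' \<Longrightarrow> extends p p' \<Longrightarrow> progress P p' d q d'"
  unfolding progress_def using side_blocked_mono by blast

end

section \<open>Instantiation by oracle programs and the stages of the construction\<close>

definition computed_color :: "nat \<Rightarrow> (nat \<Rightarrow> nat \<Rightarrow> bool) \<Rightarrow> nat \<Rightarrow> nat \<Rightarrow> bool \<Rightarrow> bool" where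
  "computed_color e f x s b \<longleftrightarrow> eval (code f) (from_nat e) [prod_encode (x, s)] (if b then 1 else 0)"

definition outputs :: "nat \<Rightarrow> nat \<Rightarrow> nat set \<Rightarrow> bool" where
  "outputs i k Z \<longleftrightarrow> eval (alt Z) (from_nat i) [k] 1"

lemma in_code: "prod_encode (x, y) \<in> code f \<longleftrightarrow> x < y \<and> f x y"
  unfolding code_def by auto

lemma code_agree:
  assumes "\<forall>i j. i < j \<and> j < u \<longrightarrow> f' i j = f i j" "k < u"
  shows "k \<in> code f' \<longleftrightarrow> k \<in> code f"
proof -
  obtain x y where k: "k = prod_encode (x, y)" by (metis prod_decode_inverse surj_pair)
  have "y < u" using le_prod_encode_2[of y x] assms(2) unfolding k by simp
  then show ?thesis using assms(1) unfolding k in_code by auto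
qed

interpretation partial_coloring "computed_color e" for e
proof
  show "b' = b" if "computed_color e f x s b" "computed_color e f x s b'" for f x s b b'
    using eval_det[OF that(1)[unfolded computed_color_def] that(2)[unfolded computed_color_def]] by (auto split: if_splits)
  fix f x s b assume "computed_color e f x s b"
  from eval_use[OF this[unfolded computed_color_def]] obtain u where u: "\<forall>B. (\<forall>i<u. (i \<in> B) = (i \<in> code f)) \<longrightarrow>
    eval B (from_nat e) [prod_encode (x, s)] (if b then 1 else 0)" ..
  have "computed_color e f' x s b" if "\<forall>i j. i < j \<and> j < u \<longrightarrow> f' i j = f i j" for f'
    unfolding computed_color_def by (rule u[THEN spec, THEN mp]) (use code_agree[OF that] in blast)
  then show "\<exists>u. \<forall>f'. (\<forall>i j. i < j \<and> j < u \<longrightarrow> f' i j = f i j) \<longrightarrow> computed_color e f' x s b" by blast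
qed

lemma is_open_outputs: "is_open (outputs i k)"
  unfolding is_open_def
proof (intro allI impI)
  fix Z assume "outputs i k Z"
  from eval_use[OF this[unfolded outputs_def]] obtain u where
    u: "\<forall>B. (\<forall>j<u. (j \<in> B) = (j \<in> alt Z)) \<longrightarrow> eval B (from_nat i) [k] 1" ..
  have "outputs i k Z'" if "Z' \<inter> {..<u} = Z \<inter> {..<u}" for Z'
    unfolding outputs_def by (rule u[THEN spec, THEN mp]) (use alt_agree[OF that] in blast)
  then show "\<exists>u. \<forall>Z'. Z' \<inter> {..<u} = Z \<inter> {..<u} \<longrightarrow> outputs i k Z'" by blast
qed

lemma outputs_eq:
  assumes "\<And>k. eval (alt Z) t [k] (if k \<in> K then 1 else 0)"
  shows "{k. outputs (to_nat t) k Z} = K"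
proof -
  have "eval (alt Z) t [k] 1 \<longleftrightarrow> k \<in> K" for k
    using assms[of k] eval_det[OF assms[of k], of 1] by (auto split: if_splits)
  then show ?thesis by (simp add: outputs_def)
qed

text \<open>The components are a program \<open>e\<close> for \<open>f'\<close>, programs
  \<open>i\<close> and \<open>j\<close> for the sides \<open>False\<close> and \<open>True\<close>,
  and a limit question \<open>(x, N, c)\<close>.\<close>

type_synonym task = "nat \<times> nat \<times> nat \<times> nat \<times> nat \<times> bool"

text \<open>Pairing with an arbitrary second coordinate lets every task recur at arbitrarily late
  stages.\<close>

definition task :: "nat \<Rightarrow> task" where
  "task n = from_nat (fst (prod_decode n))"

lemma task_recurs: "\<exists>n\<ge>m. task n = \<tau>"
proof (intro exI conjI)
  show "m \<le> prod_encode (to_nat \<tau>, m)" by (rule le_prod_encode_2)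
  show "task (prod_encode (to_nat \<tau>, m)) = \<tau>" by (simp add: task_def)
qed

definition stage :: "task \<Rightarrow> nat \<Rightarrow> cond \<Rightarrow> (nat \<Rightarrow> data) \<Rightarrow> cond \<Rightarrow> (nat \<Rightarrow> data) \<Rightarrow> bool" where
  "stage \<tau> n p D q D' \<longleftrightarrow> extends q p \<and> n \<le> len q \<and> (\<forall>e. data_extends (D e) (D' e)) \<and>
     (case \<tau> of (e, i, j, x, N, c) \<Rightarrow>
        ((\<exists>s\<ge>N. decides e q x s (\<not> c)) \<or> forces_lim e q x c N) \<and>
        progress e (\<lambda>c. outputs (if c then j else i)) p (D e) q (D' e))"

lemma stage_exists:
  assumes "\<forall>e. valid e p (D e)"
  shows "\<exists>q D'. (\<forall>e. valid e q (D' e)) \<and> stage \<tau> n p D q D'"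
proof -
  obtain e i j x N c where t: "\<tau> = (e, i, j, x, N, c)" by (cases \<tau>) auto
  obtain q0 where q0: "extends q0 p" "n \<le> len q0" using extends_exists[of p n] by metis
  obtain q1 where q1: "extends q1 q0" "(\<exists>s\<ge>N. decides e q1 x s (\<not> c)) \<or> forces_lim e q1 x c N" using decide_or_force by blast
  have q1p: "extends q1 p" using extends_trans[OF q1(1) q0(1)] .
  have inv1: "valid e' q1 (D e')" for e' using valid_mono[OF _ q1p, of e' "fst (D e')" "snd (D e')"] assms by simp
  obtain q d where q: "extends q q1" "valid e q d" "data_extends (D e) d"
      "progress e (\<lambda>c. outputs (if c then j else i)) q1 (D e) q d"
    using progress_exists[of "\<lambda>c. outputs (if c then j else i)", OF is_open_outputs inv1] by blast
  define D' where "D' = D(e := d)"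
  have "valid e' q (D' e')" for e'
    using q(2) valid_mono[OF _ q(1), of e' "fst (D e')" "snd (D e')"] inv1[of e'] by (simp add: D'_def)
  moreover have "data_extends (D e') (D' e')" for e'
    using q(3) inv1[of e'] stem_extends_refl unfolding valid_def data_extends_def D'_def by simp
  moreover have "extends q p" using extends_trans[OF q(1) q1p] .
  moreover have "n \<le> len q" using q0(2) extends_len[OF q1(1)] extends_len[OF q(1)] by simp
  moreover have "(\<exists>s\<ge>N. decides e q x s (\<not> c)) \<or> forces_lim e q x c N"
    using q1(2) decides_mono[OF _ extends_weak[OF q(1)]] forces_lim_mono[OF _ q(1) order_refl] by blast
  moreover have "progress e (\<lambda>c. outputs (if c then j else i)) p (D e) q (D' e)"
    using progress_weaken[OF q(4) q1p] by (simp add: D'_def)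
  ultimately show ?thesis unfolding stage_def t by (intro exI[of _ q] exI[of _ D']) auto
qed

lemma construction:
  obtains p D where "\<And>n e. valid e (p n) (D n e)" "\<And>n. stage (task n) (Suc n) (p n) (D n) (p (Suc n)) (D (Suc n))"
proof -
  define I where "I n pD \<longleftrightarrow> (\<forall>e. valid e (fst pD) (snd pD e))" for n :: nat and pD :: "cond \<times> (nat \<Rightarrow> data)"
  define S where "S n pD qE \<longleftrightarrow> stage (task n) (Suc n) (fst pD) (snd pD) (fst qE) (snd qE)" for n pD qE
  have "\<exists>h. \<forall>n. I n (h n) \<and> S n (h n) (h (Suc n))"
  proof (rule dependent_nat_choice)
    have "valid e (0, \<lambda>_ _. False, \<lambda>_. False) (\<lambda>_. {}, UNIV)" for e
      by (simp add: valid_def legal_def stem_def ev_def)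
    then show "\<exists>pD. I 0 pD" unfolding I_def
      by (intro exI[of _ "((0, \<lambda>_ _. False, \<lambda>_. False), \<lambda>_. (\<lambda>_. {}, UNIV))"]) simp
    fix pD n assume "I n pD"
    then obtain q E where "\<forall>e. valid e q (E e)" "stage (task n) (Suc n) (fst pD) (snd pD) q E"
      using stage_exists[of "fst pD" "snd pD"] unfolding I_def by blast
    then show "\<exists>qE. I (Suc n) qE \<and> S n pD qE" unfolding I_def S_def by (intro exI[of _ "(q, E)"]) simp
  qed
  then obtain h where "\<forall>n. I n (h n) \<and> S n (h n) (h (Suc n))" ..
  then show ?thesis using that[of "\<lambda>n. fst (h n)" "\<lambda>n. snd (h n)"] unfolding I_def S_def by simp
qed

section \<open>The generic colouring and its verification\<close>

theorem no_strong_reduction: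
  "\<exists>f. stable f \<and> (\<forall>f'. stable f' \<and> turing_reducible (code f') (code f) \<longrightarrow>
     (\<exists>H. inc_p_homogeneous f' H \<and> (\<forall>K. turing_reducible K H \<longrightarrow> \<not> p_homogeneous f K)))"
proof -
  obtain p D where valid: "\<And>n e. valid e (p n) (D n e)"
    and stage: "\<And>n. stage (task n) (Suc n) (p n) (D n) (p (Suc n)) (D (Suc n))"
    using construction by blast
  have S: "extends (p (Suc n)) (p n)" "Suc n \<le> len (p (Suc n))" "data_extends (D n e) (D (Suc n) e)" for n e
    using stage[of n] unfolding stage_def by auto
  have extends: "extends (p m) (p n)" if "n \<le> m" for n m
    using that
  proof (induction m rule: dec_induct)
    case base show ?case by (rule extends_refl)
  next
    case (step m) then show ?case using extends_trans[OF S(1)] by blast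
  qed
  have dext: "data_extends (D n e) (D m e)" if "n \<le> m" for n m e
    using that
  proof (induction m rule: dec_induct)
    case base show ?case using valid[of e n] stem_extends_refl unfolding valid_def data_extends_def by simp
  next
    case (step m) then show ?case using data_extends_trans[OF _ S(3)] by blast
  qed
  have len: "n \<le> len (p n)" for n using S(2) by (cases n) auto
  \<comment> \<open>\<open>len (p (Suc y))\<close> exceeds \<open>y\<close>, so this value is
    final.\<close>
  define f where "f x y = col (p (Suc y)) x y" for x y
  have f_cyl: "f \<in> cyl (p n)" for n
    unfolding cyl_def agrees_def
  proof (intro CollectI conjI allI impI)
    fix x y assume a: "x < y \<and> y < len (p n)"
    have "y < len (p (Suc y))" using len[of "Suc y"] by simp
    then show "f x y = col (p n) x y"
      using a extends[of "Suc y" n] extends[of n "Suc y"] nle_le[of n "Suc y"] unfolding f_def extends_def weak_extends_def by metis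
  next
    fix x y assume a: "x < len (p n) \<and> len (p n) \<le> y"
    then have "n \<le> Suc y" using len[of n] by simp
    then show "f x y = limval (p n) x" using extends[of n "Suc y"] a len[of "Suc y"] unfolding f_def extends_def by simp
  qed
  have "stable f" unfolding stable_def
  proof
    fix x
    have "x < len (p (Suc x))" using len[of "Suc x"] by simp
    then have "\<forall>u>len (p (Suc x)). f x u = limval (p (Suc x)) x" using f_cyl[of "Suc x"] unfolding cyl_def by simp
    then show "\<exists>c N. \<forall>u>N. f x u = c" by blast
  qed
  moreover have "\<exists>H. inc_p_homogeneous f' H \<and> (\<forall>K. turing_reducible K H \<longrightarrow> \<not> p_homogeneous f K)"
    if f': "stable f'" "turing_reducible (code f') (code f)" for f'
  proof -
    obtain t where t: "\<And>k. eval (code f) t [k] (if k \<in> code f' then 1 else 0)"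
      using f'(2) unfolding turing_reducible_def by blast
    define e where "e = to_nat t"
    \<comment> \<open>\<open>code f'\<close> contains only pairs with \<open>x < s\<close>; for
      other inputs the computed colour is \<open>False\<close>.\<close>
    have F: "computed_color e f x s (x < s \<and> f' x s)" for x s
      using t[of "prod_encode (x, s)"] unfolding computed_color_def e_def in_code by simp
    have F_iff: "computed_color e f x s b \<longleftrightarrow> b = (x < s \<and> f' x s)" for x s b
      using F[of x s] F_det[OF F[of x s], of b] by blast
    have not_never_stable: "\<not> never_stable e (p n)" for n
    proof
      assume "never_stable e (p n)"
      then consider x s where "\<And>q b. extends q (p n) \<Longrightarrow> \<not> decides e q x s b"
        | x where "\<And>q c N. extends q (p n) \<Longrightarrow> \<not> forces_lim e q x c N" unfolding never_stable_def by blast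
      then show False
      proof cases
        case (1 x s)
        show False using decide[OF f_cyl F[of x s], of n] 1 by metis
      next
        case (2 x)
        obtain c N0 where c: "\<And>u. N0 < u \<Longrightarrow> f' x u = c" using f'(1) unfolding stable_def by metis
        \<comment> \<open>Beyond \<open>x\<close> the computed colour is that of \<open>f'\<close>,
          and beyond \<open>N0\<close> it is the limit \<open>c\<close>.\<close>
        define N where "N = Suc (max x N0)"
        obtain m where m: "n \<le> m" "task m = (e, 0, 0, x, N, c)" using task_recurs by metis
        have "\<not> decides e (p (Suc m)) x s (\<not> c)" if "N \<le> s" for s
        proof
          assume "decides e (p (Suc m)) x s (\<not> c)"
          then have "computed_color e f x s (\<not> c)" using cyl_agrees[OF f_cyl] unfolding decides_def by blast
          moreover have "x < s" "N0 < s" using that unfolding N_def by auto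
          ultimately show False using c[of s] unfolding F_iff by simp
        qed
        then have "forces_lim e (p (Suc m)) x c N" using stage[of m] m(2) unfolding stage_def by auto
        then show False using 2 extends[of n "Suc m"] m(1) by simp
      qed
    qed
    define s where "s n c = fst (D n e) c" for n c
    define X where "X n = snd (D n e)" for n
    have mono: "s n c \<subseteq> s m c" "s m c \<subseteq> s n c \<union> X n" "X m \<subseteq> X n" if "n \<le> m" for n m c
      using dext[OF that, of e] unfolding data_extends_def stem_extends_def s_def X_def by auto
    have stem: "stem (s n c) (X n)" "legal e c (p n) (s n c) (X n)" for n c
      using valid[of e n] unfolding valid_def s_def X_def by auto
    have visit: "\<exists>m\<ge>n. (\<forall>c. side_blocked e (\<not> c) (p m) (X m) \<longrightarrow>
          defeats (outputs (if c then j else i)) (p (Suc m)) (s (Suc m) c) (X (Suc m)) \<and> card (s m c) < card (s (Suc m) c)) \<and>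
        ((\<exists>c. side_blocked e c (p (Suc m)) (X (Suc m))) \<or>
         (\<forall>c. card (s m c) < card (s (Suc m) c)) \<and>
         (\<exists>c. defeats (outputs (if c then j else i)) (p (Suc m)) (s (Suc m) c) (X (Suc m))))" for n i j
    proof -
      obtain m where m: "n \<le> m" "task m = (e, i, j, 0, 0, True)" using task_recurs by metis
      then have "progress e (\<lambda>c. outputs (if c then j else i)) (p m) (D m e) (p (Suc m)) (D (Suc m) e)"
        using stage[of m] unfolding stage_def by auto
      then show ?thesis using m(1) not_never_stable[of "Suc m"] unfolding progress_def s_def X_def by blast
    qed
    \<comment> \<open>A blocked side stays blocked, and later visits then serve the opposite side
      for every program. With no blocked side ever, a program \<open>i\<close> that is never
      defeated on \<open>False\<close> makes all pairs \<open>(i, j)\<close> be won on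
      \<open>True\<close>.\<close>
    have "\<exists>c. (\<forall>n. \<exists>m\<ge>n. card (s m c) < card (s (Suc m) c)) \<and>
              (\<forall>i. \<exists>n. defeats (outputs i) (p n) (s n c) (X n))"
    proof (cases "\<exists>c n. side_blocked e (\<not> c) (p n) (X n)")
      case True
      then obtain c n0 where n0: "side_blocked e (\<not> c) (p n0) (X n0)" by blast
      have *: "\<exists>m\<ge>n. card (s m c) < card (s (Suc m) c) \<and> defeats (outputs i) (p (Suc m)) (s (Suc m) c) (X (Suc m))" for n i
      proof -
        obtain m where m: "max n n0 \<le> m" "side_blocked e (\<not> c) (p m) (X m) \<longrightarrow>
          defeats (outputs (if c then i else i)) (p (Suc m)) (s (Suc m) c) (X (Suc m)) \<and> card (s m c) < card (s (Suc m) c)"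
          using visit[of "max n n0" i i] by blast
        have "side_blocked e (\<not> c) (p m) (X m)" using side_blocked_mono[OF n0 extends[of n0 m] mono(3)[of n0 m]] m(1) by simp
        then show ?thesis using m by (intro exI[of _ m]) simp
      qed
      then show ?thesis by blast
    next
      case False
      then have "\<not> side_blocked e (\<not> \<not> c) (p n) (X n)" for c n by blast
      then have "\<not> side_blocked e c (p n) (X n)" for c n by simp
      then have v: "\<exists>m\<ge>n. (\<forall>c. card (s m c) < card (s (Suc m) c)) \<and>
         (\<exists>c. defeats (outputs (if c then j else i)) (p (Suc m)) (s (Suc m) c) (X (Suc m)))" for n i j
        using visit[of n j i] by blast
      have g: "\<forall>n. \<exists>m\<ge>n. card (s m c) < card (s (Suc m) c)" for c using v by blast
      show ?thesis
      proof (cases "\<forall>i. \<exists>n. defeats (outputs i) (p n) (s n False) (X n)")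
        case True
        then show ?thesis using g by blast
      next
        case False
        then obtain i where i: "\<And>n. \<not> defeats (outputs i) (p n) (s n False) (X n)" by blast
        have "\<exists>n. defeats (outputs j) (p n) (s n True) (X n)" for j
        proof -
          obtain m c where "defeats (outputs (if c then j else i)) (p (Suc m)) (s (Suc m) c) (X (Suc m))" using v by blast
          then show ?thesis using i[of "Suc m"] by (cases c) auto
        qed
        then show ?thesis using g by blast
      qed
    qed
    then obtain c where grow: "\<And>n. \<exists>m\<ge>n. card (s m c) < card (s (Suc m) c)"
      and defeats: "\<And>i. \<exists>n. defeats (outputs i) (p n) (s n c) (X n)" by blast
    define Y where "Y = (\<Union>n. s n c)"
    have big: "\<exists>n. k \<le> card (s n c)" for k
    proof (induction k)
      case (Suc k)
      then obtain n where n: "k \<le> card (s n c)" ..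
      obtain m where m: "n \<le> m" "card (s m c) < card (s (Suc m) c)" using grow by blast
      have "card (s n c) \<le> card (s m c)" using mono(1)[OF m(1)] stem(1)[of m c] unfolding stem_def by (simp add: card_mono)
      then show ?case using n m(2) by (intro exI[of _ "Suc m"]) simp
    qed simp
    have infY: "infinite Y"
    proof
      assume fin: "finite Y"
      obtain n where "Suc (card Y) \<le> card (s n c)" using big by blast
      moreover have "card (s n c) \<le> card Y" using fin by (intro card_mono) (auto simp: Y_def)
      ultimately show False by simp
    qed
    have Y: "Y = s n c \<union> (Y - s n c)" "Y - s n c \<subseteq> X n" for n
    proof -
      show "Y = s n c \<union> (Y - s n c)" unfolding Y_def by blast
      have "s m c \<subseteq> s n c \<union> X n" for m using mono(1,2)[of n m c] mono(1)[of m n c] nle_le[of m n] by blast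
      then show "Y - s n c \<subseteq> X n" unfolding Y_def by blast
    qed
    have "inc_p_homogeneous f' (alt Y)"
      unfolding inc_p_homogeneous_def
    proof (rule exI[of _ "ev Y"], rule exI[of _ "od Y"], intro exI[of _ c] conjI ballI impI)
      show "alt Y = join (ev Y) (od Y)" by (rule alt_def)
      show "infinite (ev Y)" "infinite (od Y)" using infinite_ev_od[OF infY] by blast+
      fix x y assume xy: "x \<in> ev Y" "y \<in> od Y" "x < y"
      then obtain n m where "x \<in> s n c" "y \<in> s m c" using ev_subset unfolding Y_def by blast
      then have s: "x \<in> s (max n m) c" "y \<in> s (max n m) c" using mono(1)[of n "max n m" c] mono(1)[of m "max n m" c] by auto
      let ?n = "max n m"
      \<comment> \<open>Later elements of \<open>Y\<close> lie above the stem, so parities of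
        positions in the stem are those in \<open>Y\<close>.\<close>
      have "a < b" if "a \<in> s ?n c" "b \<in> Y - s ?n c" for a b
        using that Y(2)[of ?n] stem(1)[of ?n c] unfolding stem_def by blast
      from ev_initial[of "s ?n c" "Y - s ?n c", OF this] have "x \<in> ev (s ?n c)" "y \<in> od (s ?n c)"
        using s xy Y(1)[of ?n] by auto
      then have "\<not> computed_color e f x y (\<not> c)" using stem(2)[of c ?n] xy(3) f_cyl unfolding legal_def by blast
      then show "f' x y = c" using xy(3) unfolding F_iff by simp
    qed
    moreover have "\<not> p_homogeneous f K" if "turing_reducible K (alt Y)" for K
    proof -
      obtain t where "\<And>k. eval (alt Y) t [k] (if k \<in> K then 1 else 0)"
        using \<open>turing_reducible K (alt Y)\<close> unfolding turing_reducible_def by blast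
      then have K: "{k. outputs (to_nat t) k Y} = K" by (rule outputs_eq)
      obtain n where n: "defeats (outputs (to_nat t)) (p n) (s n c) (X n)" using defeats by blast
      have "infinite (Y - s n c)" using infY stem(1)[of n c] unfolding stem_def by simp
      then have "\<not> p_homogeneous f {k. outputs (to_nat t) k (s n c \<union> (Y - s n c))}"
        using n f_cyl Y(2)[of n] unfolding defeats_def by blast
      then show ?thesis using K Y(1)[of n] by simp
    qed
    ultimately show ?thesis by blast
  qed
  ultimately show ?thesis by blast
qed

theorem theorem4p1:
  shows "\<exists>(f :: nat \<Rightarrow> nat \<Rightarrow> bool) (Y :: nat set set).
    stable f \<and> (\<forall>P\<in>Y. infinite P) \<and>
    (\<forall>P\<in>Y. \<forall>H. turing_reducible H (join (code f) P) \<longrightarrow> \<not> p_homogeneous f H) \<and>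
    (\<forall>f' :: nat \<Rightarrow> nat \<Rightarrow> bool. stable f' \<and> turing_reducible (code f') (code f) \<longrightarrow>
       (\<exists>P\<in>Y. \<exists>H. turing_reducible H (join (code f) P) \<and> inc_p_homogeneous f' H) \<or>
       (\<exists>H. inc_p_homogeneous f' H \<and> (\<forall>K. turing_reducible K H \<longrightarrow> \<not> p_homogeneous f K)))"
proof -
  obtain f where "stable f" "\<forall>f'. stable f' \<and> turing_reducible (code f') (code f) \<longrightarrow>
     (\<exists>H. inc_p_homogeneous f' H \<and> (\<forall>K. turing_reducible K H \<longrightarrow> \<not> p_homogeneous f K))"
    using no_strong_reduction by blast
  then show ?thesis by (intro exI[of _ f] exI[of _ "{}"]) simp
qed

end
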